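(* Let $(\mathcal{A},\varphi)$ be a non-commutative probability space and let $(a,b)$ be a two-faced pair in $(\mathcal{A},\varphi)$ (that is, $a,b\in\mathcal{A}$, with $a$ regarded as a left and $b$ as a right operator) with $\varphi(a)=\varphi(b)=1$. Then, as a formal power series, $$S_{a,b}(z,w)=1+\frac{1+z+w}{zw}\,K_{a,b}\!\left(c_a^{\langle-1\rangle}(z),\,c_b^{\langle-1\rangle}(w)\right),$$ where $S_{a,b}$ is the $2$-variable partial bi-free $S$-transform of $(a,b)$.
   Context: A non-commutative probability space $(\mathcal{A},\varphi)$ is a unital complex algebra $\mathcal{A}$ with a linear functional $\varphi:\mathcal{A}\to\mathbb{C}$ such that $\varphi(I)=1$. All series are treated as formal series in commuting variables; $\langle -1\rangle$ denotes the inverse under composition. One-variable series. $\kappa_n(a)$ is the $n$-th free cumulant of $a$ and $c_a(z)=\sum_{n\ge1}\kappa_n(a)z^n$. For $\varphi(a)\ne0$, $\psi_a(z)=\sum_{n\ge1}\varphi(a^n)z^n$ and $\mathcal{X}_a(z)=\psi_a^{\langle-1\rangle}(z)$. Bi-non-crossing partitions and $(\ell,r)$-cumulants. For $\chi:\{1,\dots,n\}\to\{\ell,r\}$, order $\{1,\dots,n\}$ by listing first the elements of $\chi^{-1}(\ell)$ in increasing order and then the elements of $\chi^{-1}(r)$ in decreasing order. $BNC(\chi)$ is the set of partitions of $\{1,\dots,n\}$ that are non-crossing with respect to this order. The $(\ell,r)$-cumulants $\kappa_\chi:\mathcal{A}^n\to\mathbb{C}$ are the multilinear functionals determined recursively by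 $$\varphi(a_1\cdots a_n)=\sum_{\pi\in BNC(\chi)}\ \prod_{B\text{ block of }\pi}\kappa_{\chi|_B}\big((a_1,\dots,a_n)|_B\big),$$ where $(a_1,\dots,a_n)|_B$ keeps only the entries with index in $B$. For $n,m\ge1$, $\kappa_{n,m}(a,b)=\kappa_{\chi}(a,\dots,a,b,\dots,b)$ with $n$ copies of $a$ followed by $m$ copies of $b$, where $\chi(k)=\ell$ for $k\le n$ and $\chi(k)=r$ for $n<k\le n+m$. Define $$K_{a,b}(z,w)=\sum_{n,m\ge1}\kappa_{n,m}(a,b)z^nw^m .$$ The $S$-transform. Let $H_{a,b}(z,w)=\sum_{n,m\ge0}\varphi(a^nb^m)z^nw^m$. For $\varphi(a)\neq0$ and $\varphi(b)\ne0$, $$S_{a,b}(z,w)=\frac{z+1}{z}\,\frac{w+1}{w}\left(1-\frac{1+z+w}{H_{a,b}(\mathcal{X}_a(z),\mathcal{X}_b(w))}\right).$$ *)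

theory Defs
  imports
    Complex_Main
    "HOL-Library.Disjoint_Sets"
    "HOL-Computational_Algebra.Formal_Laurent_Series"
begin

section \<open>Non-commutative probability spaces\<close>

locale nc_probability_space =
  Vector_Spaces.linear scale "(*)" \<phi>
  for scale :: "complex \<Rightarrow> 'a::ring_1 \<Rightarrow> 'a" and \<phi> :: "'a \<Rightarrow> complex" +
  assumes scale_mult_left: "scale c x * y = scale c (x * y)"
    and scale_mult_right: "x * scale c y = scale c (x * y)"
    and unital: "\<phi> 1 = 1"


section \<open>Non-crossing and bi-non-crossing partitions\<close>

text \<open>Positions are counted from 0, in accordance with \<^const>\<open>nth\<close> and \<^const>\<open>nths\<close>:
  the index set of a tuple of length \<open>n\<close> is \<open>{..<n}\<close>.\<close>

definition noncrossing :: "('i \<Rightarrow> 'i \<Rightarrow> bool) \<Rightarrow> 'i set set \<Rightarrow> bool" where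
  "noncrossing prec \<pi> \<longleftrightarrow>
     (\<forall>V\<in>\<pi>. \<forall>W\<in>\<pi>. V \<noteq> W \<longrightarrow>
        \<not> (\<exists>i\<in>V. \<exists>j\<in>W. \<exists>k\<in>V. \<exists>l\<in>W. prec i j \<and> prec j k \<and> prec k l))"

definition NC :: "nat \<Rightarrow> nat set set set" where
  "NC n = {\<pi>. partition_on {..<n} \<pi> \<and> noncrossing (<) \<pi>}"

datatype face = Left | Right

text \<open>The left positions come first, in increasing order, followed by the right positions
  in decreasing order.\<close>

definition face_less :: "face list \<Rightarrow> nat \<Rightarrow> nat \<Rightarrow> bool" where
  "face_less \<chi> i j \<longleftrightarrow>
     \<chi> ! i = Left \<and> \<chi> ! j = Left \<and> i < j \<or>
     \<chi> ! i = Left \<and> \<chi> ! j = Right \<or>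
     \<chi> ! i = Right \<and> \<chi> ! j = Right \<and> j < i"

definition BNC :: "face list \<Rightarrow> nat set set set" where
  "BNC \<chi> = {\<pi>. partition_on {..<length \<chi>} \<pi> \<and> noncrossing (face_less \<chi>) \<pi>}"

lemma finite_NC: "finite (NC n)"
  unfolding NC_def
  by (rule finite_subset[OF _ finitely_many_partition_on[of "{..<n}"]]) auto

lemma finite_BNC: "finite (BNC \<chi>)"
  unfolding BNC_def
  by (rule finite_subset[OF _ finitely_many_partition_on[of "{..<length \<chi>}"]]) auto

lemma single_block_in_NC: "0 < n \<Longrightarrow> {{..<n}} \<in> NC n"
  by (auto simp: NC_def noncrossing_def partition_on_def disjoint_def)

lemma single_block_in_BNC: "\<chi> \<noteq> [] \<Longrightarrow> {{..<length \<chi>}} \<in> BNC \<chi>"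
  by (auto simp: BNC_def noncrossing_def partition_on_def disjoint_def lessThan_empty_iff)

lemma proper_block_card:
  assumes "partition_on {..<n::nat} \<pi>" and "\<pi> \<noteq> {{..<n}}" and "B \<in> \<pi>"
  shows "card B < n"
proof -
  have sub: "B \<subseteq> {..<n}"
    using assms(1,3) by (auto simp: partition_on_def)
  have "B \<noteq> {..<n}"
  proof
    assume B: "B = {..<n}"
    have "C = B" if C: "C \<in> \<pi>" for C
    proof (rule ccontr)
      assume "C \<noteq> B"
      then have "C \<inter> B = {}"
        using assms(1,3) C by (auto simp: partition_on_def disjoint_def)
      moreover have "C \<subseteq> B" "C \<noteq> {}"
        using assms(1) C B by (auto simp: partition_on_def)
      ultimately show False by blast
    qed
    then have "\<pi> = {B}" using assms(3) by blast
    with B assms(2) show False by simp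
  qed
  with sub have "B \<subset> {..<n}" by blast
  then have "card B < card {..<n}" by (intro psubset_card_mono) auto
  then show ?thesis by simp
qed

lemma length_nths_proper_block:
  assumes "\<pi> \<in> BNC \<chi>" and "\<pi> \<noteq> {{..<length \<chi>}}" and "B \<in> \<pi>"
  shows "length (nths \<chi> B) < length \<chi>"
proof -
  have "B \<subseteq> {..<length \<chi>}"
    using assms(1,3) by (auto simp: BNC_def partition_on_def)
  then have "{i. i < length \<chi> \<and> i \<in> B} = B" by auto
  then show ?thesis
    using proper_block_card[of "length \<chi>" \<pi> B] assms by (simp add: length_nths BNC_def)
qed


section \<open>Cumulants\<close>

text \<open>The moment-cumulant formulas are solved for the term of the one-block partition.
  The formulas themselves are proved below for every positive length.\<close>

context
  notes sum.cong [fundef_cong] prod.cong [fundef_cong]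
begin

function free_cumulant :: "('a::ring_1 \<Rightarrow> complex) \<Rightarrow> 'a \<Rightarrow> nat \<Rightarrow> complex" where
  "free_cumulant \<phi> a n =
     \<phi> (a ^ n) - (\<Sum>\<pi>\<in>NC n - {{{..<n}}}. \<Prod>B\<in>\<pi>. free_cumulant \<phi> a (card B))"
  by pat_completeness auto
termination
  by (relation "measure (\<lambda>(\<phi>, a, n). n)") (auto simp: NC_def intro: proper_block_card)

function lr_cumulant ::
    "('a::ring_1 \<Rightarrow> complex) \<Rightarrow> face list \<Rightarrow> 'a list \<Rightarrow> complex" where
  "lr_cumulant \<phi> \<chi> as =
     \<phi> (prod_list as) -
     (\<Sum>\<pi>\<in>BNC \<chi> - {{{..<length \<chi>}}}. \<Prod>B\<in>\<pi>. lr_cumulant \<phi> (nths \<chi> B) (nths as B))"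
  by pat_completeness auto
termination
  by (relation "measure (\<lambda>(\<phi>, \<chi>, as). length \<chi>)") (auto intro: length_nths_proper_block)

end

declare free_cumulant.simps [simp del] lr_cumulant.simps [simp del]

lemma free_moment_cumulant:
  assumes "0 < n"
  shows "\<phi> (a ^ n) = (\<Sum>\<pi>\<in>NC n. \<Prod>B\<in>\<pi>. free_cumulant \<phi> a (card B))"
  by (subst sum.remove[OF finite_NC single_block_in_NC[OF assms]])
    (simp add: free_cumulant.simps[of \<phi> a n])

lemma lr_moment_cumulant:
  assumes "\<chi> \<noteq> []" and "length as = length \<chi>"
  shows "\<phi> (prod_list as) =
    (\<Sum>\<pi>\<in>BNC \<chi>. \<Prod>B\<in>\<pi>. lr_cumulant \<phi> (nths \<chi> B) (nths as B))"
proof -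
  have "nths \<chi> {..<length \<chi>} = \<chi>" "nths as {..<length \<chi>} = as"
    using assms(2) by (auto simp: nths_upt_eq_take)
  then show ?thesis
    by (subst sum.remove[OF finite_BNC single_block_in_BNC[OF assms(1)]])
      (simp add: lr_cumulant.simps[of \<phi> \<chi> as])
qed

definition pair_cumulant ::
    "('a::ring_1 \<Rightarrow> complex) \<Rightarrow> 'a \<Rightarrow> 'a \<Rightarrow> nat \<Rightarrow> nat \<Rightarrow> complex" where
  "pair_cumulant \<phi> a b n m =
     lr_cumulant \<phi> (replicate n Left @ replicate m Right) (replicate n a @ replicate m b)"


section \<open>Formal series in one and two variables\<close>

text \<open>A series in \<open>z\<close> and \<open>w\<close> is a power series in \<open>w\<close> whose coefficients are power series
  in \<open>z\<close>: the coefficient of \<open>z\<^sup>n w\<^sup>m\<close> in \<open>F\<close> is \<open>F $ m $ n\<close>.\<close>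

definition fps2 :: "(nat \<Rightarrow> nat \<Rightarrow> complex) \<Rightarrow> complex fps fps" where
  "fps2 c = Abs_fps (\<lambda>m. Abs_fps (\<lambda>n. c n m))"

text \<open>The series \<open>F(f(z), g(w))\<close>, for \<open>f\<close> and \<open>g\<close> without constant term.\<close>

definition fps2_subst ::
    "complex fps fps \<Rightarrow> complex fps \<Rightarrow> complex fps \<Rightarrow> complex fps fps" where
  "fps2_subst F f g =
     Abs_fps (\<lambda>m. F $ m oo f) oo Abs_fps (\<lambda>m. fps_const (g $ m))"

text \<open>Division by \<open>z\<close> and \<open>w\<close> takes place in the field of iterated Laurent series,
  which contains the ring of power series in \<open>z\<close> and \<open>w\<close>.\<close>

definition fps2_to_fls2 :: "complex fps fps \<Rightarrow> complex fls fls" where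
  "fps2_to_fls2 F = fps_to_fls (Abs_fps (\<lambda>m. fps_to_fls (F $ m)))"

definition var_z :: "complex fls fls" where
  "var_z = fls_const fls_X"

definition var_w :: "complex fls fls" where
  "var_w = fls_X"

definition cumulant_series :: "('a::ring_1 \<Rightarrow> complex) \<Rightarrow> 'a \<Rightarrow> complex fps" where
  "cumulant_series \<phi> a = Abs_fps (\<lambda>n. if n = 0 then 0 else free_cumulant \<phi> a n)"

definition moment_series :: "('a::ring_1 \<Rightarrow> complex) \<Rightarrow> 'a \<Rightarrow> complex fps" where
  "moment_series \<phi> a = Abs_fps (\<lambda>n. if n = 0 then 0 else \<phi> (a ^ n))"

definition pair_cumulant_series ::
    "('a::ring_1 \<Rightarrow> complex) \<Rightarrow> 'a \<Rightarrow> 'a \<Rightarrow> complex fps fps" where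
  "pair_cumulant_series \<phi> a b =
     fps2 (\<lambda>n m. if n = 0 \<or> m = 0 then 0 else pair_cumulant \<phi> a b n m)"

definition pair_moment_series ::
    "('a::ring_1 \<Rightarrow> complex) \<Rightarrow> 'a \<Rightarrow> 'a \<Rightarrow> complex fps fps" where
  "pair_moment_series \<phi> a b = fps2 (\<lambda>n m. \<phi> (a ^ n * b ^ m))"

text \<open>\<^const>\<open>fps_inv\<close> is the inverse under composition for a series with zero constant term
  and nonzero linear coefficient; here the linear coefficients are \<open>\<phi> a\<close> and \<open>\<phi> b\<close>.\<close>

definition S_transform ::
    "('a::ring_1 \<Rightarrow> complex) \<Rightarrow> 'a \<Rightarrow> 'a \<Rightarrow> complex fls fls" where
  "S_transform \<phi> a b =
     (var_z + 1) / var_z * ((var_w + 1) / var_w) *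
     (1 - (1 + var_z + var_w) /
        fps2_to_fls2 (fps2_subst (pair_moment_series \<phi> a b)
          (fps_inv (moment_series \<phi> a)) (fps_inv (moment_series \<phi> b))))"

end

theory Submission
  imports Defs
begin

text \<open>Write \<open>M\<^sub>a = 1 + \<psi>\<^sub>a\<close> for the full moment series, and \<open>H\<close> and \<open>K\<close> for the moment and cumulant
  series of the pair.  Everything follows from two identities of formal series,
  \<open>c\<^sub>a(s M\<^sub>a(s)) = M\<^sub>a(s) - 1\<close> and
  \<open>H(s, t) (1 - K(s M\<^sub>a(s), t M\<^sub>b(t))) = M\<^sub>a(s) M\<^sub>b(t)\<close>.
  At \<open>s = \<X>\<^sub>a(z)\<close> one has \<open>M\<^sub>a(s) = 1 + z\<close>, and the first identity gives \<open>s M\<^sub>a(s)\<close> as the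
  compositional inverse of \<open>c\<^sub>a\<close> at \<open>z\<close>; likewise for \<open>t = \<X>\<^sub>b(w)\<close>.  The second identity
  then reads \<open>H (1 - K) = (1 + z) (1 + w)\<close>, with \<open>H\<close> and \<open>K\<close> evaluated as in the theorem
  (\<open>pair_moment_cumulant_at_inverses\<close>), and the formula follows by solving for \<open>K\<close> in a field.
  It describes a power series because every term of \<open>K\<close> is divisible by \<open>z w\<close>, which cancels the
  denominator (\<open>fps2_subst_multiple_of_zw\<close>).

  Both identities (\<open>cumulant_series_compose\<close>, \<open>pair_moment_series_relation\<close>) come from one
  decomposition of non-crossing partitions.  Consider the block of the least position and reveal
  its elements in increasing order.  Each new element cuts off a segment whose blocks
  lie entirely inside it, because they must not cross the revealed block; the sum over the
  partitions of that segment is again a moment.  The recursion \<open>open_sum_rec\<close> expresses this, and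
  \<open>open_sum_interval\<close> and \<open>open_sum_two_faced\<close> sum it up as generating series.

  For the pair, the order prescribed by the faces lists all left positions before all right
  positions, so the positions are taken to be integers, negative on the left and nonnegative on the
  right.  A segment on one side contributes a moment of \<open>a\<close> or of \<open>b\<close>; only a segment across the
  frontier contributes a mixed moment, and the block of the least position cuts off just one such
  segment if that position is on the left.  Hence the second identity is linear in \<open>H\<close>.\<close>

section \<open>Splitting non-crossing partitions at a block\<close>

lemma noncrossingI:
  assumes "\<And>V W i j k l. \<lbrakk>V \<in> \<pi>; W \<in> \<pi>; V \<noteq> W; i \<in> V; j \<in> W; k \<in> V; l \<in> W;
    prec i j; prec j k; prec k l\<rbrakk> \<Longrightarrow> False"
  shows "noncrossing prec \<pi>"
  unfolding noncrossing_def
  by (intro ballI impI notI, elim bexE conjE) (rule assms)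

lemma noncrossingD:
  "\<lbrakk>noncrossing prec \<pi>; V \<in> \<pi>; W \<in> \<pi>; V \<noteq> W; i \<in> V; j \<in> W; k \<in> V; l \<in> W;
    prec i j; prec j k; prec k l\<rbrakk> \<Longrightarrow> False"
  unfolding noncrossing_def by meson

lemma noncrossing_subset: "noncrossing prec \<pi> \<Longrightarrow> \<rho> \<subseteq> \<pi> \<Longrightarrow> noncrossing prec \<rho>"
  by (rule noncrossingI) (erule noncrossingD, erule subsetD, assumption, erule subsetD, assumption+)

lemma noncrossing_cong:
  assumes "\<And>i j. i \<in> \<Union>\<pi> \<Longrightarrow> j \<in> \<Union>\<pi> \<Longrightarrow> prec i j \<longleftrightarrow> prec' i j"
  shows "noncrossing prec \<pi> \<longleftrightarrow> noncrossing prec' \<pi>"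
proof -
  have "noncrossing r' \<pi>"
    if nc: "noncrossing r \<pi>" and eq: "\<And>i j. i \<in> \<Union>\<pi> \<Longrightarrow> j \<in> \<Union>\<pi> \<Longrightarrow> r i j \<longleftrightarrow> r' i j" for r r'
  proof (rule noncrossingI)
    fix V W i j k l
    assume a: "V \<in> \<pi>" "W \<in> \<pi>" "V \<noteq> W" "i \<in> V" "j \<in> W" "k \<in> V" "l \<in> W"
      and "r' i j" "r' j k" "r' k l"
    moreover have "i \<in> \<Union>\<pi>" "j \<in> \<Union>\<pi>" "k \<in> \<Union>\<pi>" "l \<in> \<Union>\<pi>" using a by blast+
    ultimately show False by (intro noncrossingD[OF nc a]) (simp_all add: eq)
  qed
  then show ?thesis using assms by metis
qed

lemma noncrossing_reverse: "noncrossing (\<lambda>i j. prec j i) \<pi> \<longleftrightarrow> noncrossing prec \<pi>"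
proof -
  have "noncrossing (\<lambda>i j. r j i) \<pi>" if nc: "noncrossing r \<pi>" for r
  proof (rule noncrossingI)
    fix V W i j k l
    assume "V \<in> \<pi>" "W \<in> \<pi>" "V \<noteq> W" "i \<in> V" "j \<in> W" "k \<in> V" "l \<in> W" "r j i" "r k j" "r l k"
    then show False using noncrossingD[OF nc, of W V l k j i] by blast
  qed
  from this[of prec] this[of "\<lambda>i j. prec j i"] show ?thesis by blast
qed

definition nc_on :: "'i::linorder set \<Rightarrow> 'i set set set" where
  "nc_on A = {\<pi>. partition_on A \<pi> \<and> noncrossing (<) \<pi>}"

definition nc_sum :: "('i::linorder set \<Rightarrow> 'c::comm_ring_1) \<Rightarrow> 'i set \<Rightarrow> 'c" where
  "nc_sum w A = (\<Sum>\<pi>\<in>nc_on A. \<Prod>B\<in>\<pi>. w B)"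

text \<open>Think of a block that has an element below all of \<open>A\<close> and meets \<open>A\<close> in \<open>V\<close>.  The
  other blocks in \<open>A\<close> do not cross it exactly when none of them has an element of \<open>V\<close> between
  two of its own elements, because the element below \<open>A\<close> completes every such pattern to a
  crossing.\<close>

definition nc_around :: "'i::linorder set \<Rightarrow> 'i set \<Rightarrow> 'i set set set" where
  "nc_around V A = {\<sigma>. partition_on (A - V) \<sigma> \<and> noncrossing (<) \<sigma> \<and>
     (\<forall>B\<in>\<sigma>. \<forall>i\<in>B. \<forall>k\<in>B. \<forall>v\<in>V. \<not> (i < v \<and> v < k))}"

definition around_sum :: "('i::linorder set \<Rightarrow> 'c::comm_ring_1) \<Rightarrow> 'i set \<Rightarrow> 'i set \<Rightarrow> 'c" where
  "around_sum w V A = (\<Sum>\<sigma>\<in>nc_around V A. \<Prod>B\<in>\<sigma>. w B)"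

text \<open>The block with an element below \<open>A\<close> is left open: it may take up any subset \<open>V\<close> of \<open>A\<close>,
  and \<open>v V\<close> is its weight once it has done so.  Keeping \<open>v\<close> separate from the weight \<open>w\<close> of the
  closed blocks allows \<open>v\<close> to remember the elements taken up earlier.\<close>

definition open_sum ::
    "('i::linorder set \<Rightarrow> 'c::comm_ring_1) \<Rightarrow> ('i set \<Rightarrow> 'c) \<Rightarrow> 'i set \<Rightarrow> 'c" where
  "open_sum w v A = (\<Sum>V\<in>Pow A. v V * around_sum w V A)"

lemma finite_nc_around: "finite A \<Longrightarrow> finite (nc_around V A)"
  unfolding nc_around_def by (rule finite_subset[OF _ finitely_many_partition_on[of "A - V"]]) auto

lemma finite_block_set: "finite A \<Longrightarrow> \<pi> \<in> nc_on A \<Longrightarrow> finite \<pi>"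
  "finite A \<Longrightarrow> \<pi> \<in> nc_around V A \<Longrightarrow> finite \<pi>"
  unfolding nc_on_def nc_around_def using finite_elements[of "A - V" \<pi>] finite_elements[of A \<pi>]
  by auto

lemma nc_sum_empty [simp]:
  fixes w :: "'i::linorder set \<Rightarrow> 'c::comm_ring_1"
  shows "nc_sum w {} = 1"
proof -
  have "nc_on ({} :: 'i set) = {{}}"
    by (auto simp: nc_on_def partition_on_empty noncrossing_def)
  then show ?thesis by (simp add: nc_sum_def)
qed

lemma nc_sum_cong:
  assumes "\<And>B. B \<subseteq> A \<Longrightarrow> B \<noteq> {} \<Longrightarrow> w B = w' B"
  shows "nc_sum w A = nc_sum w' A"
  unfolding nc_sum_def using assms
  by (intro sum.cong prod.cong refl) (auto simp: nc_on_def partition_on_def)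

lemma around_sum_empty: "around_sum w {} A = nc_sum w A"
  by (simp add: around_sum_def nc_sum_def nc_around_def nc_on_def)

text \<open>No block can have elements on both sides of \<open>x\<close>, the least element of the open block in \<open>A\<close>.
  Hence the partitions around \<open>insert x V\<close> are exactly the unions of a non-crossing partition
  below \<open>x\<close>, where the open block imposes nothing more, and a partition above \<open>x\<close> around \<open>V\<close>.\<close>

lemma around_sum_insert:
  fixes A :: "'i::linorder set"
  assumes fin: "finite A" and x: "x \<in> A" and V: "V \<subseteq> {y\<in>A. x < y}"
  shows "around_sum w (insert x V) A
    = nc_sum w {y\<in>A. y < x} * around_sum w V {y\<in>A. x < y}"
proof -
  let ?L = "{y\<in>A. y < x}" and ?R = "{y\<in>A. x < y}"
  let ?join = "\<lambda>(\<sigma>\<^sub>1, \<sigma>\<^sub>2). \<sigma>\<^sub>1 \<union> \<sigma>\<^sub>2 :: 'i set set"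
  let ?split = "\<lambda>\<sigma>. ({B\<in>\<sigma>. B \<subseteq> {..<x}}, {B\<in>\<sigma>. B \<subseteq> {x<..}})"
  have side: "B \<subseteq> {..<x} \<or> B \<subseteq> {x<..}" if "\<sigma> \<in> nc_around (insert x V) A" "B \<in> \<sigma>" for \<sigma> B
  proof -
    have "x \<notin> B" and nb: "\<And>i k. i \<in> B \<Longrightarrow> k \<in> B \<Longrightarrow> \<not> (i < x \<and> x < k)"
      using that by (auto simp: nc_around_def partition_on_def)
    then show ?thesis
      by (metis greaterThan_iff lessThan_iff not_less_iff_gr_or_eq subsetI)
  qed
  have split_mem: "?split \<sigma> \<in> nc_on ?L \<times> nc_around V ?R"
    if s: "\<sigma> \<in> nc_around (insert x V) A" for \<sigma>
  proof -
    have un: "\<Union>\<sigma> = A - insert x V" and dis: "disjoint \<sigma>" and ne: "{} \<notin> \<sigma>"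
      and nc: "noncrossing (<) \<sigma>"
      and out: "\<And>B i k v. B \<in> \<sigma> \<Longrightarrow> i \<in> B \<Longrightarrow> k \<in> B \<Longrightarrow> v \<in> V \<Longrightarrow> \<not> (i < v \<and> v < k)"
      using s by (auto simp: nc_around_def partition_on_def)
    have "\<Union>{B\<in>\<sigma>. B \<subseteq> {..<x}} = ?L"
    proof (intro equalityI subsetI)
      fix y assume y: "y \<in> ?L"
      then have "y \<in> A - insert x V" using V by auto
      then obtain B where "B \<in> \<sigma>" "y \<in> B" using un by blast
      moreover from this y side[OF s] have "B \<subseteq> {..<x}" by force
      ultimately show "y \<in> \<Union>{B\<in>\<sigma>. B \<subseteq> {..<x}}" by blast
    qed (use un in auto)
    moreover have "\<Union>{B\<in>\<sigma>. B \<subseteq> {x<..}} = ?R - V"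
    proof (intro equalityI subsetI)
      fix y assume y: "y \<in> ?R - V"
      then have "y \<in> A - insert x V" by auto
      then obtain B where "B \<in> \<sigma>" "y \<in> B" using un by blast
      moreover from this y side[OF s] have "B \<subseteq> {x<..}" by force
      ultimately show "y \<in> \<Union>{B\<in>\<sigma>. B \<subseteq> {x<..}}" by blast
    qed (use un in auto)
    moreover have "noncrossing (<) {B\<in>\<sigma>. B \<subseteq> {..<x}}" "noncrossing (<) {B\<in>\<sigma>. B \<subseteq> {x<..}}"
      by (rule noncrossing_subset[OF nc], blast)+
    moreover have "disjoint {B\<in>\<sigma>. B \<subseteq> {..<x}}" "disjoint {B\<in>\<sigma>. B \<subseteq> {x<..}}"
      using dis by (auto simp: disjoint_def)
    ultimately show ?thesis
      using ne out by (auto simp: nc_on_def nc_around_def partition_on_def)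
  qed
  have join_split: "?join (?split \<sigma>) = \<sigma>" if "\<sigma> \<in> nc_around (insert x V) A" for \<sigma>
    using side[OF that] by auto
  have parts: "\<sigma>\<^sub>1 \<subseteq> Pow {..<x} - {{}}" "\<sigma>\<^sub>2 \<subseteq> Pow {x<..} - {{}}"
    if "(\<sigma>\<^sub>1, \<sigma>\<^sub>2) \<in> nc_on ?L \<times> nc_around V ?R" for \<sigma>\<^sub>1 \<sigma>\<^sub>2
    using that by (auto simp: nc_on_def nc_around_def partition_on_def)
  have split_join: "?split (?join p) = p" if p: "p \<in> nc_on ?L \<times> nc_around V ?R" for p
  proof -
    obtain \<sigma>\<^sub>1 \<sigma>\<^sub>2 where ps: "p = (\<sigma>\<^sub>1, \<sigma>\<^sub>2)" by (cases p)
    have dj: "\<not> B \<subseteq> {x<..}" if "B \<in> \<sigma>\<^sub>1" for B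
      using that parts(1)[of \<sigma>\<^sub>1 \<sigma>\<^sub>2] p unfolding ps by force
    have dj': "\<not> B \<subseteq> {..<x}" if "B \<in> \<sigma>\<^sub>2" for B
      using that parts(2)[of \<sigma>\<^sub>1 \<sigma>\<^sub>2] p unfolding ps by force
    show ?thesis
      using parts[of \<sigma>\<^sub>1 \<sigma>\<^sub>2] p dj dj' unfolding ps by auto
  qed
  have join_mem: "?join p \<in> nc_around (insert x V) A" if p: "p \<in> nc_on ?L \<times> nc_around V ?R" for p
  proof -
    obtain \<sigma>\<^sub>1 \<sigma>\<^sub>2 where ps: "p = (\<sigma>\<^sub>1, \<sigma>\<^sub>2)" by (cases p)
    have un: "\<Union>\<sigma>\<^sub>1 = ?L" "\<Union>\<sigma>\<^sub>2 = ?R - V" and dis: "disjoint \<sigma>\<^sub>1" "disjoint \<sigma>\<^sub>2"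
      and ne: "{} \<notin> \<sigma>\<^sub>1" "{} \<notin> \<sigma>\<^sub>2" and nc: "noncrossing (<) \<sigma>\<^sub>1" "noncrossing (<) \<sigma>\<^sub>2"
      and out: "\<And>B i k v. B \<in> \<sigma>\<^sub>2 \<Longrightarrow> i \<in> B \<Longrightarrow> k \<in> B \<Longrightarrow> v \<in> V \<Longrightarrow> \<not> (i < v \<and> v < k)"
      using p unfolding ps by (auto simp: nc_on_def nc_around_def partition_on_def)
    have lo: "\<And>B y. B \<in> \<sigma>\<^sub>1 \<Longrightarrow> y \<in> B \<Longrightarrow> y < x" and hi: "\<And>B y. B \<in> \<sigma>\<^sub>2 \<Longrightarrow> y \<in> B \<Longrightarrow> x < y"
      using un by auto
    have "\<Union>(\<sigma>\<^sub>1 \<union> \<sigma>\<^sub>2) = A - insert x V"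
      using V x un by (auto simp: not_less_iff_gr_or_eq)
    moreover have "disjoint (\<sigma>\<^sub>1 \<union> \<sigma>\<^sub>2)"
      using dis un by (intro disjoint_union) auto
    moreover have "noncrossing (<) (\<sigma>\<^sub>1 \<union> \<sigma>\<^sub>2)"
    proof (rule noncrossingI)
      fix B C i j k l
      assume BC: "B \<in> \<sigma>\<^sub>1 \<union> \<sigma>\<^sub>2" "C \<in> \<sigma>\<^sub>1 \<union> \<sigma>\<^sub>2" "B \<noteq> C"
        and m: "i \<in> B" "j \<in> C" "k \<in> B" "l \<in> C" and o: "i < j" "j < k" "k < l"
      have "B \<in> \<sigma>\<^sub>1 \<longleftrightarrow> k < x" "B \<in> \<sigma>\<^sub>1 \<longleftrightarrow> i < x" "C \<in> \<sigma>\<^sub>1 \<longleftrightarrow> j < x"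
        "B \<in> \<sigma>\<^sub>2 \<longleftrightarrow> x < k" "B \<in> \<sigma>\<^sub>2 \<longleftrightarrow> x < i" "C \<in> \<sigma>\<^sub>2 \<longleftrightarrow> x < j"
        using BC m lo hi by (metis Un_iff order.asym)+
      then have "B \<in> \<sigma>\<^sub>1 \<and> C \<in> \<sigma>\<^sub>1 \<or> B \<in> \<sigma>\<^sub>2 \<and> C \<in> \<sigma>\<^sub>2"
        using o BC by (meson UnE order.strict_trans)
      then show False
        using noncrossingD[OF nc(1) _ _ BC(3) m o] noncrossingD[OF nc(2) _ _ BC(3) m o] by blast
    qed
    moreover have "\<not> (i < v \<and> v < k)"
      if "B \<in> \<sigma>\<^sub>1 \<union> \<sigma>\<^sub>2" "i \<in> B" "k \<in> B" "v \<in> insert x V" for B i k v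
    proof (cases "B \<in> \<sigma>\<^sub>1")
      case True
      then have "k < x" "x \<le> v" using lo that V by auto
      then show ?thesis by auto
    next
      case False
      then have "B \<in> \<sigma>\<^sub>2" using that by blast
      then show ?thesis using hi[of B i] out[of B i k v] that by auto
    qed
    ultimately show ?thesis
      using ne unfolding ps nc_around_def partition_on_def by simp
  qed
  have weight: "(\<Prod>B\<in>?join p. w B) = (case p of (\<sigma>\<^sub>1, \<sigma>\<^sub>2) \<Rightarrow> (\<Prod>B\<in>\<sigma>\<^sub>1. w B) * (\<Prod>B\<in>\<sigma>\<^sub>2. w B))"
    if p: "p \<in> nc_on ?L \<times> nc_around V ?R" for p
  proof -
    obtain \<sigma>\<^sub>1 \<sigma>\<^sub>2 where ps: "p = (\<sigma>\<^sub>1, \<sigma>\<^sub>2)" by (cases p)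
    have "finite \<sigma>\<^sub>1" "finite \<sigma>\<^sub>2"
      using p fin finite_block_set[of ?L \<sigma>\<^sub>1] finite_block_set(2)[of ?R \<sigma>\<^sub>2 V] unfolding ps by auto
    moreover have "\<sigma>\<^sub>1 \<inter> \<sigma>\<^sub>2 = {}"
    proof -
      have "B = {}" if "B \<subseteq> {..<x}" "B \<subseteq> {x<..}" for B :: "'i set" using that by force
      then show ?thesis using parts[of \<sigma>\<^sub>1 \<sigma>\<^sub>2] p unfolding ps by blast
    qed
    ultimately show ?thesis unfolding ps by (simp add: prod.union_disjoint)
  qed
  have weight': "(case ?split \<sigma> of (\<sigma>\<^sub>1, \<sigma>\<^sub>2) \<Rightarrow> (\<Prod>B\<in>\<sigma>\<^sub>1. w B) * (\<Prod>B\<in>\<sigma>\<^sub>2. w B)) = (\<Prod>B\<in>\<sigma>. w B)"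
    if "\<sigma> \<in> nc_around (insert x V) A" for \<sigma>
    using weight[OF split_mem[OF that]] unfolding join_split[OF that] by (rule sym)
  have "around_sum w (insert x V) A
      = (\<Sum>p\<in>nc_on ?L \<times> nc_around V ?R. case p of (\<sigma>\<^sub>1, \<sigma>\<^sub>2) \<Rightarrow> (\<Prod>B\<in>\<sigma>\<^sub>1. w B) * (\<Prod>B\<in>\<sigma>\<^sub>2. w B))"
    unfolding around_sum_def
    by (rule sum.reindex_bij_witness[where i = ?join and j = ?split])
      (fact join_split split_mem split_join join_mem weight')+
  also have "\<dots> = nc_sum w ?L * around_sum w V ?R"
    by (simp add: nc_sum_def around_sum_def sum_product sum.cartesian_product)
  finally show ?thesis .
qed

text \<open>The block of the least element plays the part of the open block.\<close>

lemma nc_sum_insert_least: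
  fixes A :: "'i::linorder set"
  assumes fin: "finite A" and x: "\<And>y. y \<in> A \<Longrightarrow> x < y"
  shows "nc_sum w (insert x A) = open_sum w (\<lambda>V. w (insert x V)) A"
proof -
  let ?P = "Sigma (Pow A) (\<lambda>V. nc_around V A)"
  let ?add = "\<lambda>(V, \<sigma>). insert (insert x V) \<sigma>"
  let ?blk = "\<lambda>\<pi>. THE B. B \<in> \<pi> \<and> x \<in> B"
  let ?rem = "\<lambda>\<pi>. (?blk \<pi> - {x}, \<pi> - {?blk \<pi>})"
  have xA: "x \<notin> A" using x by blast
  have blk: "?blk \<pi> = B" if "\<pi> \<in> nc_on (insert x A)" "B \<in> \<pi>" "x \<in> B" for \<pi> B
    using that by (intro the_equality) (auto simp: nc_on_def partition_on_def disjoint_def)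
  have ex: "\<exists>B\<in>\<pi>. x \<in> B" if "\<pi> \<in> nc_on (insert x A)" for \<pi>
    using that by (auto simp: nc_on_def partition_on_def)
  have rem_mem: "?rem \<pi> \<in> ?P" and add_rem: "?add (?rem \<pi>) = \<pi>"
    if p: "\<pi> \<in> nc_on (insert x A)" for \<pi>
  proof -
    obtain B where B: "B \<in> \<pi>" "x \<in> B" using ex[OF p] by blast
    have un: "\<Union>\<pi> = insert x A" and dis: "\<And>C D. C \<in> \<pi> \<Longrightarrow> D \<in> \<pi> \<Longrightarrow> C \<noteq> D \<Longrightarrow> C \<inter> D = {}"
      and ne: "{} \<notin> \<pi>" and nc: "noncrossing (<) \<pi>"
      using p by (auto simp: nc_on_def partition_on_def disjoint_def)
    have "\<Union>(\<pi> - {B}) = A - (B - {x})"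
    proof (intro equalityI subsetI)
      fix y assume "y \<in> \<Union>(\<pi> - {B})"
      then obtain C where C: "C \<in> \<pi>" "C \<noteq> B" "y \<in> C" by blast
      then have "y \<notin> B" using dis[OF C(1) B(1) C(2)] by blast
      moreover have "y \<in> insert x A" using C un by blast
      ultimately show "y \<in> A - (B - {x})" using B by blast
    next
      fix y assume y: "y \<in> A - (B - {x})"
      then obtain C where "C \<in> \<pi>" "y \<in> C" using un by blast
      then show "y \<in> \<Union>(\<pi> - {B})" using y xA by blast
    qed
    moreover have "\<not> (i < v \<and> v < k)"
      if "C \<in> \<pi> - {B}" "i \<in> C" "k \<in> C" "v \<in> B" for C i k v
    proof
      assume iv: "i < v \<and> v < k"
      have "i \<in> insert x A" "i \<noteq> x" using that B dis[of C B] un by blast+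
      then have "x < i" using x by blast
      then show False using iv that B by (intro noncrossingD[OF nc, of B C x i v k]) auto
    qed
    moreover have "noncrossing (<) (\<pi> - {B})" by (rule noncrossing_subset[OF nc]) blast
    ultimately have "(B - {x}, \<pi> - {B}) \<in> ?P"
      using un dis ne B unfolding nc_around_def partition_on_def disjoint_def by auto
    then show "?rem \<pi> \<in> ?P" "?add (?rem \<pi>) = \<pi>"
      using B by (simp_all add: blk[OF p B] insert_absorb)
  qed
  have add_mem: "?add p \<in> nc_on (insert x A)" and rem_add: "?rem (?add p) = p"
    and weight: "(\<Prod>B\<in>?add p. w B) = (case p of (V, \<sigma>) \<Rightarrow> w (insert x V) * (\<Prod>B\<in>\<sigma>. w B))"
    if p: "p \<in> ?P" for p
  proof -
    obtain V \<sigma> where ps: "p = (V, \<sigma>)" by (cases p)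
    have V: "V \<subseteq> A" and un: "\<Union>\<sigma> = A - V" and dis: "disjoint \<sigma>" and ne: "{} \<notin> \<sigma>"
      and nc: "noncrossing (<) \<sigma>"
      and out: "\<And>B i k v. B \<in> \<sigma> \<Longrightarrow> i \<in> B \<Longrightarrow> k \<in> B \<Longrightarrow> v \<in> V \<Longrightarrow> \<not> (i < v \<and> v < k)"
      using p unfolding ps by (auto simp: nc_around_def partition_on_def)
    have "\<Union>(insert (insert x V) \<sigma>) = insert x A" using V un by auto
    moreover have "disjoint (insert (insert x V) \<sigma>)"
      using dis un xA by (auto simp: disjoint_def)
    moreover have "noncrossing (<) (insert (insert x V) \<sigma>)"
    proof (rule noncrossingI)
      fix B C i j k l
      assume BC: "B \<in> insert (insert x V) \<sigma>" "C \<in> insert (insert x V) \<sigma>" "B \<noteq> C"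
        and m: "i \<in> B" "j \<in> C" "k \<in> B" "l \<in> C" and o: "i < j" "j < k" "k < l"
      have "i \<in> insert x A" using BC(1) m(1) V un by blast
      then have "x \<le> i" using x[of i] by auto
      then have "j \<noteq> x" "k \<noteq> x" using o by auto
      consider "B = insert x V" "C \<in> \<sigma>" | "C = insert x V" "B \<in> \<sigma>" | "B \<in> \<sigma>" "C \<in> \<sigma>"
        using BC by blast
      then show False
      proof cases
        case 1
        then show False using out[of C j l k] m o \<open>k \<noteq> x\<close> by blast
      next
        case 2
        then show False using out[of B i k j] m o \<open>j \<noteq> x\<close> by blast
      next
        case 3
        then show False using noncrossingD[OF nc _ _ BC(3) m o] by blast
      qed
    qed
    ultimately show mem: "?add p \<in> nc_on (insert x A)"
      using ne unfolding ps nc_on_def partition_on_def by auto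
    have fresh: "insert x V \<notin> \<sigma>" using un xA by blast
    have "?blk (insert (insert x V) \<sigma>) = insert x V"
      by (rule blk) (use mem in \<open>auto simp: ps\<close>)
    then show "?rem (?add p) = p"
      using fresh V xA unfolding ps by auto
    have "finite \<sigma>" using p fin finite_block_set(2)[of A \<sigma> V] unfolding ps by blast
    then show "(\<Prod>B\<in>?add p. w B) = (case p of (V, \<sigma>) \<Rightarrow> w (insert x V) * (\<Prod>B\<in>\<sigma>. w B))"
      using fresh unfolding ps by simp
  qed
  have weight': "(case ?rem \<pi> of (V, \<sigma>) \<Rightarrow> w (insert x V) * (\<Prod>B\<in>\<sigma>. w B)) = (\<Prod>B\<in>\<pi>. w B)"
    if "\<pi> \<in> nc_on (insert x A)" for \<pi>
    using weight[OF rem_mem[OF that]] unfolding add_rem[OF that] by (rule sym)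
  have "nc_sum w (insert x A)
      = (\<Sum>p\<in>?P. case p of (V, \<sigma>) \<Rightarrow> w (insert x V) * (\<Prod>B\<in>\<sigma>. w B))"
    unfolding nc_sum_def
    by (rule sum.reindex_bij_witness[where i = ?add and j = ?rem])
      (fact add_rem rem_mem rem_add add_mem weight')+
  also have "\<dots> = (\<Sum>V\<in>Pow A. \<Sum>\<sigma>\<in>nc_around V A. w (insert x V) * (\<Prod>B\<in>\<sigma>. w B))"
    using fin by (subst sum.Sigma) (auto intro: finite_nc_around)
  also have "\<dots> = open_sum w (\<lambda>V. w (insert x V)) A"
    by (simp add: open_sum_def around_sum_def sum_distrib_left)
  finally show ?thesis .
qed

text \<open>Either the open block takes up nothing more, or the next element \<open>x\<close> that it takes up
  separates \<open>A\<close> into two independent parts.  If \<open>A\<close> is an interval, so are both parts.\<close>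

lemma open_sum_rec:
  fixes A :: "'i::linorder set"
  assumes fin: "finite A"
  shows "open_sum w v A = v {} * nc_sum w A +
    (\<Sum>x\<in>A. nc_sum w {y\<in>A. y < x} * open_sum w (\<lambda>V. v (insert x V)) {y\<in>A. x < y})"
proof -
  let ?R = "\<lambda>x. {y\<in>A. x < y}"
  have "Pow A - {{}} = (\<Union>x\<in>A. insert x ` Pow (?R x))"
  proof (intro equalityI subsetI)
    fix V assume V: "V \<in> Pow A - {{}}"
    then have "finite V" "V \<noteq> {}" using fin finite_subset by auto
    then have "Min V \<in> V" "V - {Min V} \<subseteq> ?R (Min V)"
      using V by (auto simp: order.strict_iff_order)
    then show "V \<in> (\<Union>x\<in>A. insert x ` Pow (?R x))"
      using V by (intro UN_I[of "Min V"] image_eqI[of _ _ "V - {Min V}"]) auto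
  qed auto
  moreover have "open_sum w v A = v {} * nc_sum w A + (\<Sum>V\<in>Pow A - {{}}. v V * around_sum w V A)"
    using fin unfolding open_sum_def by (subst sum.remove[of _ "{}"]) (auto simp: around_sum_empty)
  ultimately have "open_sum w v A = v {} * nc_sum w A +
      (\<Sum>V\<in>(\<Union>x\<in>A. insert x ` Pow (?R x)). v V * around_sum w V A)"
    by simp
  also have "(\<Sum>V\<in>(\<Union>x\<in>A. insert x ` Pow (?R x)). v V * around_sum w V A)
      = (\<Sum>x\<in>A. \<Sum>V\<in>insert x ` Pow (?R x). v V * around_sum w V A)"
  proof (intro sum.UNION_disjoint ballI impI)
    fix x y assume "x \<in> A" "y \<in> A" "x \<noteq> y"
    moreover have False if "insert x V = insert y W" "V \<subseteq> ?R x" "W \<subseteq> ?R y" for V W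
    proof -
      have "x \<in> insert y W" "y \<in> insert x V" using that(1) by (metis insertI1)+
      then have "x \<in> W" "y \<in> V" using \<open>x \<noteq> y\<close> by simp_all
      then have "y < x" "x < y" using that(2,3) by blast+
      then show False by simp
    qed
    ultimately show "insert x ` Pow (?R x) \<inter> insert y ` Pow (?R y) = {}" by blast
  qed (use fin in auto)
  also have "\<dots> = (\<Sum>x\<in>A. \<Sum>V\<in>Pow (?R x). v (insert x V) * around_sum w (insert x V) A)"
  proof (rule sum.cong[OF refl])
    fix x
    have "inj_on (insert x) (Pow (?R x))" by (auto simp: inj_on_def)
    then show "(\<Sum>V\<in>insert x ` Pow (?R x). v V * around_sum w V A)
        = (\<Sum>V\<in>Pow (?R x). v (insert x V) * around_sum w (insert x V) A)"
      by (simp add: sum.reindex)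
  qed
  also have "\<dots> = (\<Sum>x\<in>A. nc_sum w {y\<in>A. y < x} * open_sum w (\<lambda>V. v (insert x V)) (?R x))"
    unfolding open_sum_def sum_distrib_left
    by (intro sum.cong refl) (simp add: around_sum_insert[OF fin] mult_ac)
  finally show ?thesis .
qed

lemma nc_sum_reindex:
  fixes f :: "'j \<Rightarrow> 'i::linorder"
  assumes inj: "inj_on f A" and mono: "\<And>i j. i \<in> A \<Longrightarrow> j \<in> A \<Longrightarrow> prec i j \<longleftrightarrow> f i < f j"
  shows "(\<Sum>\<pi> | partition_on A \<pi> \<and> noncrossing prec \<pi>. \<Prod>B\<in>\<pi>. w (f ` B)) = nc_sum w (f ` A)"
proof -
  let ?g = "inv_into A f"
  have img: "(`) f ` \<pi> \<in> nc_on (f ` A)"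
    if p: "partition_on A \<pi>" and nc: "noncrossing prec \<pi>" for \<pi>
  proof -
    have sub: "\<And>B. B \<in> \<pi> \<Longrightarrow> B \<subseteq> A" and ne: "{} \<notin> \<pi>"
      using p by (auto simp: partition_on_def)
    then have "(`) f ` \<pi> - {{}} = (`) f ` \<pi>" by auto
    with partition_on_inj_image[OF p inj] have "partition_on (f ` A) ((`) f ` \<pi>)" by simp
    moreover have "noncrossing (<) ((`) f ` \<pi>)"
    proof (rule noncrossingI)
      fix B' C' i' j' k' l'
      assume b: "B' \<in> (`) f ` \<pi>" "C' \<in> (`) f ` \<pi>" "B' \<noteq> C'" "i' \<in> B'" "j' \<in> C'" "k' \<in> B'"
        "l' \<in> C'" "i' < j'" "j' < k'" "k' < l'"
      obtain B C where BC: "B \<in> \<pi>" "B' = f ` B" "C \<in> \<pi>" "C' = f ` C"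
        using b(1,2) by (elim imageE)
      obtain i j k l where "i \<in> B" "j \<in> C" "k \<in> B" "l \<in> C" "i' = f i" "j' = f j" "k' = f k"
        "l' = f l"
        using b(4-7) unfolding BC(2,4) by (elim imageE)
      with b BC have a: "B \<in> \<pi>" "C \<in> \<pi>" "f ` B \<noteq> f ` C" "i \<in> B" "j \<in> C" "k \<in> B" "l \<in> C"
        "f i < f j" "f j < f k" "f k < f l"
        by simp_all
      then have "i \<in> A" "j \<in> A" "k \<in> A" "l \<in> A" using sub by blast+
      then show False using a mono by (intro noncrossingD[OF nc, of B C i j k l]) auto
    qed
    ultimately show ?thesis by (simp add: nc_on_def)
  qed
  have inv: "partition_on A ((`) ?g ` \<rho>) \<and> noncrossing prec ((`) ?g ` \<rho>)"
    and inv2: "(`) f ` ((`) ?g ` \<rho>) = \<rho>"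
    if r: "\<rho> \<in> nc_on (f ` A)" for \<rho>
  proof -
    have p: "partition_on (f ` A) \<rho>" and nc: "noncrossing (<) \<rho>"
      using r by (auto simp: nc_on_def)
    have sub: "\<And>B. B \<in> \<rho> \<Longrightarrow> B \<subseteq> f ` A" and ne: "{} \<notin> \<rho>"
      using p by (auto simp: partition_on_def)
    have fg: "f ` (?g ` B) = B" if "B \<in> \<rho>" for B
      using sub[OF that] by (simp add: image_inv_into_cancel)
    then show "(`) f ` ((`) ?g ` \<rho>) = \<rho>" by (force simp: image_iff)
    have "(`) ?g ` \<rho> - {{}} = (`) ?g ` \<rho>" using ne by auto
    moreover have "?g ` f ` A = A" using inj by (simp add: inj_on_image_eq_iff)
    ultimately have "partition_on A ((`) ?g ` \<rho>)"
      using partition_on_inj_image[OF p inj_on_inv_into[OF subset_refl]] by simp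
    moreover have "noncrossing prec ((`) ?g ` \<rho>)"
    proof (rule noncrossingI)
      fix B' C' i' j' k' l'
      assume b: "B' \<in> (`) ?g ` \<rho>" "C' \<in> (`) ?g ` \<rho>" "B' \<noteq> C'" "i' \<in> B'" "j' \<in> C'" "k' \<in> B'"
        "l' \<in> C'" "prec i' j'" "prec j' k'" "prec k' l'"
      obtain B C where BC: "B \<in> \<rho>" "B' = ?g ` B" "C \<in> \<rho>" "C' = ?g ` C"
        using b(1,2) by (elim imageE)
      obtain i j k l where "i \<in> B" "j \<in> C" "k \<in> B" "l \<in> C" "i' = ?g i" "j' = ?g j" "k' = ?g k"
        "l' = ?g l"
        using b(4-7) unfolding BC(2,4) by (elim imageE)
      with b BC have a: "B \<in> \<rho>" "C \<in> \<rho>" "?g ` B \<noteq> ?g ` C" "i \<in> B" "j \<in> C" "k \<in> B" "l \<in> C"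
        "prec (?g i) (?g j)" "prec (?g j) (?g k)" "prec (?g k) (?g l)"
        by simp_all
      have mem: "i \<in> f ` A" "j \<in> f ` A" "k \<in> f ` A" "l \<in> f ` A" using a sub by blast+
      then have "i < j" "j < k" "k < l"
        using a(8-10) mono by (simp_all add: f_inv_into_f inv_into_into)
      then show False using a by (intro noncrossingD[OF nc, of B C i j k l]) auto
    qed
    ultimately show "partition_on A ((`) ?g ` \<rho>) \<and> noncrossing prec ((`) ?g ` \<rho>)" ..
  qed
  have gf: "(`) ?g ` ((`) f ` \<pi>) = \<pi>" and injB: "inj_on ((`) f) \<pi>" if "partition_on A \<pi>" for \<pi>
  proof -
    have sub: "\<And>B. B \<in> \<pi> \<Longrightarrow> B \<subseteq> A" using that by (auto simp: partition_on_def)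
    then have "?g ` f ` B = B" if "B \<in> \<pi>" for B
      using that inj by (simp add: inv_into_image_cancel)
    then show "(`) ?g ` ((`) f ` \<pi>) = \<pi>" by (force simp: image_iff)
    show "inj_on ((`) f) \<pi>"
      using sub inj by (meson inj_onI inj_on_image_eq_iff)
  qed
  show ?thesis
    unfolding nc_sum_def
    by (rule sum.reindex_bij_witness[where i = "(`) ((`) ?g)" and j = "(`) ((`) f)"])
      (use img inv inv2 gf injB in \<open>simp_all add: prod.reindex\<close>)
qed


section \<open>Ring homomorphisms applied to coefficients\<close>

definition fps_map :: "('c \<Rightarrow> 'd) \<Rightarrow> 'c fps \<Rightarrow> 'd fps" where
  "fps_map h F = Abs_fps (\<lambda>n. h (F $ n))"

lemma fps_map_nth [simp]: "fps_map h F $ n = h (F $ n)"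
  by (simp add: fps_map_def)

text \<open>Several operations below act on a series coefficient by coefficient: the passage from series
  in \<open>w\<close> alone to series in \<open>z\<close> and \<open>w\<close>, substitution for \<open>z\<close>, and the embedding into Laurent
  series.  That they respect products and compositions has the same proof each time.\<close>

locale coeff_hom =
  fixes h :: "'c::comm_ring_1 \<Rightarrow> 'd::comm_ring_1"
  assumes hom_add: "h (x + y) = h x + h y"
    and hom_mult: "h (x * y) = h x * h y"
    and hom_one: "h 1 = 1"
begin

lemma hom_zero: "h 0 = 0"
  using hom_add[of 0 0] by simp

lemma hom_diff: "h (x - y) = h x - h y"
  using hom_add[of "x - y" y] by (simp add: algebra_simps)

lemma hom_sum: "h (sum f I) = (\<Sum>i\<in>I. h (f i))"
  by (induction I rule: infinite_finite_induct) (simp_all add: hom_zero hom_add)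

lemma map_add: "fps_map h (F + G) = fps_map h F + fps_map h G"
  by (simp add: fps_eq_iff hom_add)

lemma map_const: "fps_map h (fps_const c) = fps_const (h c)"
  by (simp add: fps_eq_iff hom_zero)

lemma map_one: "fps_map h 1 = 1"
  using map_const[of 1] by (simp add: hom_one)

lemma map_X: "fps_map h fps_X = fps_X"
  by (simp add: fps_eq_iff fps_X_def hom_zero hom_one)

lemma map_mult: "fps_map h (F * G) = fps_map h F * fps_map h G"
  by (simp add: fps_eq_iff fps_mult_nth hom_sum hom_mult)

lemma map_power: "fps_map h (F ^ n) = fps_map h F ^ n"
  by (induction n) (simp_all add: map_one map_mult)

lemma map_compose: "fps_map h (F oo G) = fps_map h F oo fps_map h G"
  by (simp add: fps_eq_iff fps_compose_nth hom_sum hom_mult flip: map_power)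

end

interpretation const_hom: coeff_hom "fps_const :: complex \<Rightarrow> complex fps"
  by unfold_locales simp_all

interpretation to_fls_hom: coeff_hom "fps_to_fls :: complex fps \<Rightarrow> complex fls"
  by unfold_locales (simp_all add: fls_times_fps_to_fls)

lemma compose_hom: "f $ 0 = 0 \<Longrightarrow> coeff_hom (\<lambda>x :: complex fps. x oo f)"
  by unfold_locales (simp_all add: fps_compose_add_distrib fps_compose_mult_distrib)


section \<open>Substitution into series in two variables\<close>

text \<open>A series in \<open>z\<close> alone is constant in the outer variable \<open>w\<close>; a series in \<open>w\<close> alone has
  coefficients that are constant in \<open>z\<close>.\<close>

abbreviation in_z :: "complex fps \<Rightarrow> complex fps fps" where
  "in_z \<equiv> fps_const"

abbreviation in_w :: "complex fps \<Rightarrow> complex fps fps" where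
  "in_w \<equiv> fps_map fps_const"

lemma fps2_subst_conv: "fps2_subst F f g = fps_map (\<lambda>x. x oo f) F oo in_w g"
  by (simp add: fps2_subst_def fps_map_def)

lemma fps2_subst_add: "fps2_subst (F + G) f g = fps2_subst F f g + fps2_subst G f g"
proof -
  have "fps_map (\<lambda>x. x oo f) (F + G) = fps_map (\<lambda>x. x oo f) F + fps_map (\<lambda>x. x oo f) G"
    by (rule fps_ext) (simp add: fps_compose_add_distrib)
  then show ?thesis by (simp add: fps2_subst_conv fps_compose_add_distrib)
qed

lemma fps2_subst_mult:
  assumes "f $ 0 = 0" "g $ 0 = 0"
  shows "fps2_subst (F * G) f g = fps2_subst F f g * fps2_subst G f g"
  using assms
  by (simp add: fps2_subst_conv coeff_hom.map_mult[OF compose_hom] fps_compose_mult_distrib)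

lemma fps2_subst_in_z: "fps2_subst (in_z x) f g = in_z (x oo f)"
proof -
  have "fps_map (\<lambda>x. x oo f) (in_z x) = in_z (x oo f)" by (simp add: fps_eq_iff)
  then show ?thesis by (simp add: fps2_subst_conv)
qed

lemma fps2_subst_in_w: "fps2_subst (in_w y) f g = in_w (y oo g)"
proof -
  have "fps_map (\<lambda>x. x oo f) (in_w y) = in_w y" by (simp add: fps_eq_iff)
  then show ?thesis by (simp add: fps2_subst_conv const_hom.map_compose)
qed

lemma fps2_subst_1: "fps2_subst 1 f g = 1"
  using fps2_subst_in_z[of 1 f g] by simp

lemma fps2_subst_hom: "f $ 0 = 0 \<Longrightarrow> g $ 0 = 0 \<Longrightarrow> coeff_hom (\<lambda>F. fps2_subst F f g)"
  by unfold_locales (simp_all add: fps2_subst_add fps2_subst_mult fps2_subst_1)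

lemma fps2_subst_subst:
  assumes "f $ 0 = 0" "g $ 0 = 0" "f' $ 0 = 0" "g' $ 0 = 0"
  shows "fps2_subst (fps2_subst F f g) f' g' = fps2_subst F (f oo f') (g oo g')"
proof -
  have "fps_map (\<lambda>x. x oo f') (fps_map (\<lambda>x. x oo f) F) = fps_map (\<lambda>x. x oo (f oo f')) F"
    using assms by (simp add: fps_eq_iff[of "fps_map _ _"] fps_compose_assoc)
  moreover have "fps_map (\<lambda>x. x oo f') (in_w g) = in_w g" by (simp add: fps_eq_iff)
  ultimately show ?thesis
    using assms
    by (simp add: fps2_subst_conv coeff_hom.map_compose[OF compose_hom] const_hom.map_compose
        fps_compose_assoc)
qed

lemma fps_split: "f = fps_const (f $ 0) + fps_X * fps_shift 1 (f :: 'c::comm_ring_1 fps)"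
  by (simp add: fps_eq_iff)

lemma fps_compose_split:
  fixes f g :: "'c::idom fps"
  assumes "g $ 0 = 0"
  shows "f oo g = fps_const (f $ 0) + g * (fps_shift 1 f oo g)"
  by (subst fps_split[of f])
    (simp add: assms fps_compose_add_distrib fps_compose_mult_distrib)

text \<open>The separation \<open>F(z, w) = F(0, w) + z F'(z, w)\<close>, evaluated at \<open>z = f\<close> and \<open>w = g\<close>.\<close>

lemma fps2_subst_split:
  assumes "f $ 0 = 0" "g $ 0 = 0"
  shows "fps2_subst F f g = in_w (fps_map (\<lambda>x. x $ 0) F oo g)
    + in_z f * fps2_subst (fps_map (fps_shift 1) F) f g"
proof -
  have "F = in_w (fps_map (\<lambda>x. x $ 0) F) + in_z fps_X * fps_map (fps_shift 1) F"
    by (simp add: fps_eq_iff)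
  then have "fps2_subst F f g = fps2_subst (in_w (fps_map (\<lambda>x. x $ 0) F)) f g
      + fps2_subst (in_z fps_X) f g * fps2_subst (fps_map (fps_shift 1) F) f g"
    using assms by (metis fps2_subst_add fps2_subst_mult)
  then show ?thesis by (simp add: fps2_subst_in_w fps2_subst_in_z assms)
qed

lemma fps_X_mult_mult_nth:
  "(fps_X * (A * B)) $ m = (\<Sum>j<m. A $ j * (B $ (m - 1 - j) :: 'c::comm_ring_1))"
proof (cases m)
  case (Suc k)
  then have "(fps_X * (A * B)) $ m = (A * B) $ k" by simp
  then show ?thesis using Suc by (simp add: fps_mult_nth atLeast0AtMost lessThan_Suc_atMost)
qed simp


section \<open>Generating series of open sums\<close>

lemma sum_int_interval: "(\<Sum>x\<in>{p..<p + int m}. g x) = (\<Sum>j<m. g (p + int j))"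
proof -
  have "{p..<p + int m} = (\<lambda>j. p + int j) ` {..<m}"
  proof (intro equalityI subsetI)
    fix x assume "x \<in> {p..<p + int m}"
    then show "x \<in> (\<lambda>j. p + int j) ` {..<m}"
      by (intro image_eqI[of _ _ "nat (x - p)"]) auto
  qed auto
  then show ?thesis by (simp add: sum.reindex inj_on_def)
qed

text \<open>On intervals where \<open>nc_sum\<close> depends only on the length, the open block takes up elements one
  by one, and each of them contributes a factor \<open>X M\<close>: the element itself and the segment that it
  cuts off.  A last factor \<open>M\<close> comes from the elements after the final one.  Formally, both
  sides satisfy the same recursion, the right one by splitting off the constant term of \<open>f\<close>.\<close>

lemma open_sum_interval:
  fixes M f :: "'c::idom fps"
  assumes seg: "\<And>q k. lo \<le> q \<Longrightarrow> nc_sum w {q..<q + int k} = M $ k"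
    and p: "lo \<le> p"
    and v: "\<And>V. V \<subseteq> {p..<p + int m} \<Longrightarrow> v V = f $ card V"
  shows "open_sum w v {p..<p + int m} = (M * (f oo (fps_X * M))) $ m"
  using p v
proof (induction m arbitrary: p v f rule: less_induct)
  case (less m)
  let ?A = "{p..<p + int m}" and ?R = "M * (fps_shift 1 f oo (fps_X * M))"
  have step: "open_sum w (\<lambda>V. v (insert (p + int j) V)) {y\<in>?A. p + int j < y} = ?R $ (m - 1 - j)"
    if j: "j < m" for j
  proof -
    have eq: "{y\<in>?A. p + int j < y} = {p + int j + 1..<p + int j + 1 + int (m - 1 - j)}"
      using j by auto
    show ?thesis
      unfolding eq
    proof (rule less.IH)
      fix V assume V: "V \<subseteq> {p + int j + 1..<p + int j + 1 + int (m - 1 - j)}"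
      then have "finite V" "p + int j \<notin> V" "insert (p + int j) V \<subseteq> ?A"
        using j by (auto intro: finite_subset)
      then show "v (insert (p + int j) V) = fps_shift 1 f $ card V"
        using less.prems(2) by simp
    qed (use j less.prems in auto)
  qed
  have low: "nc_sum w {y\<in>?A. y < p + int j} = M $ j" if "j < m" for j
  proof -
    have "{y\<in>?A. y < p + int j} = {p..<p + int j}" using that by auto
    then show ?thesis using seg[of p j] less.prems by simp
  qed
  have "open_sum w v ?A = v {} * nc_sum w ?A + (\<Sum>j<m. nc_sum w {y\<in>?A. y < p + int j} *
      open_sum w (\<lambda>V. v (insert (p + int j) V)) {y\<in>?A. p + int j < y})"
    by (subst open_sum_rec) (simp, simp only: sum_int_interval)
  also have "\<dots> = v {} * M $ m + (\<Sum>j<m. M $ j * ?R $ (m - 1 - j))"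
    by (intro arg_cong2[where f = "(+)"] sum.cong refl)
      (simp_all only: lessThan_iff low step seg[OF less.prems(1)])
  also have "\<dots> = (fps_const (f $ 0) * M + fps_X * (M * ?R)) $ m"
    using less.prems(2)[of "{}"] by (simp only: fps_X_mult_mult_nth fps_add_nth) simp
  also have "fps_const (f $ 0) * M + fps_X * (M * ?R) = M * (f oo (fps_X * M))"
    by (subst (2) fps_compose_split) (simp_all add: algebra_simps)
  finally show ?case .
qed

text \<open>Negative integers are left positions, the others right positions.  While the open block takes
  up left positions, it cuts off left segments, each with generating series \<open>Ma\<close>; the segment
  before its first right position, or the final one if there is none, may contain positions of
  both faces and gives the factor \<open>H\<close>; every right position is followed by a right segment,
  which gives \<open>Mb\<close>.  Right after taking up a right position the block is in the one-faced
  situation of \<open>open_sum_interval\<close>.\<close>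

lemma open_sum_two_faced:
  fixes H F :: "complex fps fps" and Ma Mb :: "complex fps"
  assumes left: "\<And>q k. q + int k \<le> 0 \<Longrightarrow> nc_sum w {q..<q + int k} = Ma $ k"
    and right: "\<And>q k. 0 \<le> q \<Longrightarrow> nc_sum w {q..<q + int k} = Mb $ k"
    and mixed: "\<And>n m. nc_sum w {- int n..<int m} = H $ m $ n"
    and v: "\<And>V. V \<subseteq> {- int n..<int m} \<Longrightarrow> v V = F $ card (V \<inter> {0..}) $ card (V \<inter> {..<0})"
  shows "open_sum w v {- int n..<int m}
    = (H * fps2_subst F (fps_X * Ma) (fps_X * Mb)) $ m $ n"
  using v
proof (induction n arbitrary: v F rule: less_induct)
  case (less n)
  let ?A = "{- int n..<int m}" and ?za = "fps_X * Ma" and ?wb = "fps_X * Mb"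
  let ?f = "fps_map (\<lambda>x. x $ 0) F" and ?F' = "fps_map (fps_shift 1) F"
  let ?L = "H * fps2_subst ?F' ?za ?wb" and ?R = "Mb * (fps_shift 1 ?f oo ?wb)"
  have stepL: "open_sum w (\<lambda>V. v (insert (- int n + int j) V)) {y\<in>?A. - int n + int j < y}
      = ?L $ m $ (n - 1 - j)" if j: "j < n" for j
  proof -
    have eq: "{y\<in>?A. - int n + int j < y} = {- int (n - 1 - j)..<int m}"
      using j by auto
    show ?thesis
      unfolding eq
    proof (rule less.IH)
      fix V assume V: "V \<subseteq> {- int (n - 1 - j)..<int m}"
      let ?x = "- int n + int j"
      have "finite V" "?x \<notin> V" "insert ?x V \<subseteq> ?A" "?x < 0"
        using V j by (auto intro: finite_subset)
      moreover from this have "insert ?x V \<inter> {0..} = V \<inter> {0..}"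
        "insert ?x V \<inter> {..<0} = insert ?x (V \<inter> {..<0})" by auto
      ultimately show "v (insert ?x V) = ?F' $ card (V \<inter> {0..}) $ card (V \<inter> {..<0})"
        using less.prems by simp
    qed (use j in auto)
  qed
  have stepR: "open_sum w (\<lambda>V. v (insert (int j) V)) {y\<in>?A. int j < y} = ?R $ (m - 1 - j)"
    if j: "j < m" for j
  proof -
    have eq: "{y\<in>?A. int j < y} = {int j + 1..<int j + 1 + int (m - 1 - j)}"
      using j by auto
    show ?thesis
      unfolding eq
    proof (rule open_sum_interval[where lo = 0])
      fix V assume V: "V \<subseteq> {int j + 1..<int j + 1 + int (m - 1 - j)}"
      have "finite V" "int j \<notin> V" "insert (int j) V \<subseteq> ?A"
        using V j by (auto intro: finite_subset)
      moreover have "insert (int j) V \<inter> {0..} = insert (int j) V" "insert (int j) V \<inter> {..<0} = {}"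
        using V by force+
      ultimately show "v (insert (int j) V) = fps_shift 1 ?f $ card V"
        using less.prems by simp
    qed (use right in auto)
  qed
  have lowL: "nc_sum w {y\<in>?A. y < - int n + int j} = Ma $ j" if "j < n" for j
  proof -
    have "{y\<in>?A. y < - int n + int j} = {- int n..<- int n + int j}" using that by auto
    then show ?thesis using left[of "- int n" j] that by simp
  qed
  have lowR: "nc_sum w {y\<in>?A. y < int j} = H $ j $ n" if "j < m" for j
  proof -
    have "{y\<in>?A. y < int j} = {- int n..<int j}" using that by auto
    then show ?thesis using mixed[of n j] by simp
  qed
  have split_sum: "(\<Sum>x\<in>?A. g x) = (\<Sum>j<n. g (- int n + int j)) + (\<Sum>j<m. g (int j))"
    for g :: "int \<Rightarrow> complex"
  proof -
    have "?A = {- int n..<- int n + int n} \<union> {0..<0 + int m}" by auto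
    then have "sum g ?A = sum g {- int n..<- int n + int n} + sum g {0..<0 + int m}"
      by (simp only:) (rule sum.union_disjoint, auto)
    then show ?thesis by (simp only: sum_int_interval) simp
  qed
  have v0: "v {} = ?f $ 0" using less.prems[of "{}"] by simp
  have "open_sum w v ?A = v {} * nc_sum w ?A
      + ((\<Sum>j<n. nc_sum w {y\<in>?A. y < - int n + int j} *
          open_sum w (\<lambda>V. v (insert (- int n + int j) V)) {y\<in>?A. - int n + int j < y})
        + (\<Sum>j<m. nc_sum w {y\<in>?A. y < int j} *
          open_sum w (\<lambda>V. v (insert (int j) V)) {y\<in>?A. int j < y}))"
    by (subst open_sum_rec) (simp, simp only: split_sum)
  also have "\<dots> = ?f $ 0 * H $ m $ n
      + ((\<Sum>j<n. Ma $ j * ?L $ m $ (n - 1 - j)) + (\<Sum>j<m. H $ j $ n * ?R $ (m - 1 - j)))"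
    by (intro arg_cong2[where f = "(+)"] sum.cong refl)
      (simp_all only: lessThan_iff lowL lowR stepL stepR mixed v0)
  also have "(\<Sum>j<n. Ma $ j * ?L $ m $ (n - 1 - j)) = (in_z ?za * ?L) $ m $ n"
    by (simp only: fps_mult_left_const_nth mult.assoc fps_X_mult_mult_nth)
  also have "(\<Sum>j<m. H $ j $ n * ?R $ (m - 1 - j)) = (fps_X * (H * in_w ?R)) $ m $ n"
    by (simp only: fps_X_mult_mult_nth fps_sum_nth fps_map_nth fps_mult_right_const_nth)
  also have "?f $ 0 * H $ m $ n + ((in_z ?za * ?L) $ m $ n + (fps_X * (H * in_w ?R)) $ m $ n)
      = (in_z ?za * ?L + H * (in_z (fps_const (?f $ 0)) + fps_X * in_w ?R)) $ m $ n"
    by (simp add: algebra_simps del: fps_map_nth)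
  also have "in_z (fps_const (?f $ 0)) + fps_X * in_w ?R = in_w (?f oo ?wb)"
    by (subst (2) fps_compose_split)
      (simp_all add: const_hom.map_add const_hom.map_mult const_hom.map_const const_hom.map_X
        mult.assoc del: fps_map_nth)
  also have "in_z ?za * ?L + H * in_w (?f oo ?wb) = H * fps2_subst F ?za ?wb"
    by (subst (2) fps2_subst_split) (simp_all add: algebra_simps del: fps_map_nth)
  finally show ?case .
qed


section \<open>Moments as sums over non-crossing partitions\<close>

lemma nths_replicate: "nths (replicate n x) B = replicate (card {i. i < n \<and> i \<in> B}) x"
  by (rule replicate_eqI) (auto simp: length_nths set_nths)

lemma face_less_replicate:
  "i < n \<Longrightarrow> j < n \<Longrightarrow>
    face_less (replicate n c) i j \<longleftrightarrow> (case c of Left \<Rightarrow> i < j | Right \<Rightarrow> j < i)"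
  by (cases c) (auto simp: face_less_def)

text \<open>With a single face the prescribed order is the natural one or its reverse, and crossings do
  not change under reversal.\<close>

lemma BNC_replicate: "BNC (replicate n c) = NC n"
proof -
  have "noncrossing (face_less (replicate n c)) \<pi> \<longleftrightarrow> noncrossing (<) \<pi>"
    if p: "partition_on {..<n} \<pi>" for \<pi>
  proof -
    have sub: "\<Union>\<pi> = {..<n}" using p by (auto simp: partition_on_def)
    show ?thesis
    proof (cases c)
      case Left
      show ?thesis by (rule noncrossing_cong) (simp add: face_less_replicate Left sub)
    next
      case Right
      have "noncrossing (face_less (replicate n c)) \<pi> \<longleftrightarrow> noncrossing (\<lambda>i j. j < i) \<pi>"
        by (rule noncrossing_cong) (simp add: face_less_replicate Right sub)
      also have "\<dots> \<longleftrightarrow> noncrossing (<) \<pi>" by (rule noncrossing_reverse)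
      finally show ?thesis .
    qed
  qed
  then show ?thesis by (auto simp: BNC_def NC_def)
qed

lemma lr_cumulant_replicate:
  "lr_cumulant \<phi> (replicate n c) (replicate n a) = free_cumulant \<phi> a n"
proof (induction n rule: less_induct)
  case (less n)
  have "lr_cumulant \<phi> (nths (replicate n c) B) (nths (replicate n a) B) = free_cumulant \<phi> a (card B)"
    if "\<pi> \<in> NC n - {{{..<n}}}" "B \<in> \<pi>" for \<pi> B
  proof -
    have p: "partition_on {..<n} \<pi>" "\<pi> \<noteq> {{..<n}}" using that by (auto simp: NC_def)
    then have "B \<subseteq> {..<n}" using that by (auto simp: partition_on_def)
    then have "{i. i < n \<and> i \<in> B} = B" by auto
    then show ?thesis
      using less.IH[OF proper_block_card[OF p that(2)]] by (simp add: nths_replicate)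
  qed
  then have "(\<Sum>\<pi>\<in>NC n - {{{..<n}}}. \<Prod>B\<in>\<pi>. lr_cumulant \<phi> (nths (replicate n c) B) (nths (replicate n a) B))
      = (\<Sum>\<pi>\<in>NC n - {{{..<n}}}. \<Prod>B\<in>\<pi>. free_cumulant \<phi> a (card B))"
    by (intro sum.cong prod.cong refl)
  then show ?case
    by (subst lr_cumulant.simps, subst free_cumulant.simps) (simp add: BNC_replicate)
qed

lemma nc_sum_free_cumulant:
  assumes "\<phi> 1 = 1"
  shows "nc_sum (\<lambda>B. free_cumulant \<phi> a (card B)) {q..<q + int k} = \<phi> (a ^ k)"
proof (cases "k = 0")
  case False
  let ?f = "\<lambda>i. q + int i"
  have img: "?f ` {..<k} = {q..<q + int k}"
  proof (intro equalityI subsetI)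
    fix x assume "x \<in> {q..<q + int k}"
    then show "x \<in> ?f ` {..<k}"
      by (intro image_eqI[of _ _ "nat (x - q)"]) auto
  qed auto
  have "\<phi> (a ^ k) = (\<Sum>\<pi> | partition_on {..<k} \<pi> \<and> noncrossing (<) \<pi>.
      \<Prod>B\<in>\<pi>. free_cumulant \<phi> a (card (?f ` B)))"
    using free_moment_cumulant[of k \<phi> a] False by (simp add: NC_def card_image inj_on_def)
  also have "\<dots> = nc_sum (\<lambda>B. free_cumulant \<phi> a (card B)) (?f ` {..<k})"
    by (rule nc_sum_reindex) (auto simp: inj_on_def)
  finally show ?thesis unfolding img by simp
qed (use assms in simp)

text \<open>One function for the weights of left, right and mixed blocks; on the first two it is the free
  cumulant, so that the one-variable series enter the two-faced recursion.\<close>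

definition face_cumulant :: "('a::ring_1 \<Rightarrow> complex) \<Rightarrow> 'a \<Rightarrow> 'a \<Rightarrow> nat \<Rightarrow> nat \<Rightarrow> complex" where
  "face_cumulant \<phi> a b l r =
     (if r = 0 then free_cumulant \<phi> a l else if l = 0 then free_cumulant \<phi> b r
      else pair_cumulant \<phi> a b l r)"

lemma lr_cumulant_faces:
  assumes "l + r \<noteq> 0"
  shows "lr_cumulant \<phi> (replicate l Left @ replicate r Right) (replicate l a @ replicate r b)
    = face_cumulant \<phi> a b l r"
  using lr_cumulant_replicate[of \<phi> l Left a] lr_cumulant_replicate[of \<phi> r Right b]
  by (auto simp: face_cumulant_def pair_cumulant_def)

definition block_weight :: "('a::ring_1 \<Rightarrow> complex) \<Rightarrow> 'a \<Rightarrow> 'a \<Rightarrow> int set \<Rightarrow> complex" where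
  "block_weight \<phi> a b B = face_cumulant \<phi> a b (card (B \<inter> {..<0})) (card (B \<inter> {0..}))"

lemma nc_sum_left:
  assumes "\<phi> 1 = 1" "q + int k \<le> 0"
  shows "nc_sum (block_weight \<phi> a b) {q..<q + int k} = \<phi> (a ^ k)"
proof -
  have "block_weight \<phi> a b B = free_cumulant \<phi> a (card B)" if "B \<subseteq> {q..<q + int k}" for B
  proof -
    have "B \<inter> {..<0} = B" "B \<inter> {0..} = {}" using that assms by force+
    then show ?thesis by (simp add: block_weight_def face_cumulant_def)
  qed
  then show ?thesis
    using nc_sum_free_cumulant[of \<phi>, OF assms(1)] by (subst nc_sum_cong) auto
qed

lemma nc_sum_right:
  assumes "\<phi> 1 = 1" "0 \<le> q"
  shows "nc_sum (block_weight \<phi> a b) {q..<q + int k} = \<phi> (b ^ k)"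
proof -
  have "block_weight \<phi> a b B = free_cumulant \<phi> b (card B)"
    if "B \<subseteq> {q..<q + int k}" "B \<noteq> {}" for B
  proof -
    have "B \<inter> {..<0} = {}" "B \<inter> {0..} = B" using that assms by force+
    moreover have "card B \<noteq> 0" using that by (auto simp: card_eq_0_iff dest: finite_subset)
    ultimately show ?thesis by (simp add: block_weight_def face_cumulant_def)
  qed
  then show ?thesis
    using nc_sum_free_cumulant[of \<phi>, OF assms(1)] by (subst nc_sum_cong) auto
qed

text \<open>Placing the left positions at \<open>-n, \<dots>, -1\<close> in increasing order and the right positions
  at \<open>m-1, \<dots>, 0\<close>, the first of them at \<open>m-1\<close>, turns the order prescribed by the faces into the
  order of the integers, with \<open>0\<close> as the frontier between the faces.\<close>

lemma nc_sum_two_faced: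
  assumes "\<phi> 1 = 1"
  shows "nc_sum (block_weight \<phi> a b) {- int n..<int m} = \<phi> (a ^ n * b ^ m)"
proof (cases "n + m = 0")
  case False
  let ?\<chi> = "replicate n Left @ replicate m Right" and ?as = "replicate n a @ replicate m b"
  let ?f = "\<lambda>i. if i < n then int i - int n else int n + int m - 1 - int i"
  have inj: "inj_on ?f {..<n + m}"
    by (auto simp: inj_on_def split: if_splits)
  have img: "?f ` {..<n + m} = {- int n..<int m}"
  proof (intro equalityI subsetI)
    fix x assume x: "x \<in> {- int n..<int m}"
    show "x \<in> ?f ` {..<n + m}"
    proof (cases "x < 0")
      case True
      then show ?thesis using x by (intro image_eqI[of _ _ "nat (x + int n)"]) auto
    next
      case False
      then show ?thesis using x by (intro image_eqI[of _ _ "nat (int n + int m - 1 - x)"]) auto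
    qed
  qed (auto split: if_splits)
  have order: "face_less ?\<chi> i j \<longleftrightarrow> ?f i < ?f j" if "i \<in> {..<n + m}" "j \<in> {..<n + m}" for i j
    using that by (auto simp: face_less_def nth_append)
  have weight: "lr_cumulant \<phi> (nths ?\<chi> B) (nths ?as B) = block_weight \<phi> a b (?f ` B)"
    if p: "partition_on {..<n + m} \<pi>" and B: "B \<in> \<pi>" for \<pi> B
  proof -
    have sub: "B \<subseteq> {..<n + m}" and ne: "B \<noteq> {}"
      using p B by (auto simp: partition_on_def)
    let ?l = "card {i. i < n \<and> i \<in> B}" and ?r = "card {i. i < m \<and> i + n \<in> B}"
    have "nths ?\<chi> B = replicate ?l Left @ replicate ?r Right"
      "nths ?as B = replicate ?l a @ replicate ?r b"
      by (simp_all add: nths_append nths_replicate)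
    moreover have "?l + ?r \<noteq> 0"
    proof -
      obtain i where i: "i \<in> B" using ne by blast
      then have "i \<in> {i. i < n \<and> i \<in> B} \<or> i - n \<in> {i. i < m \<and> i + n \<in> B}"
        using sub by (cases "i < n") auto
      moreover have "finite {i. i < n \<and> i \<in> B}" "finite {i. i < m \<and> i + n \<in> B}" by auto
      ultimately show ?thesis by (auto simp: card_eq_0_iff)
    qed
    moreover have "?f ` B \<inter> {..<0} = (\<lambda>i. int i - int n) ` {i. i < n \<and> i \<in> B}"
      using sub by (auto split: if_splits)
    moreover have "?f ` B \<inter> {0..} = (\<lambda>i. int m - 1 - int i) ` {i. i < m \<and> i + n \<in> B}"
    proof (intro equalityI subsetI)
      fix x assume x: "x \<in> ?f ` B \<inter> {0..}"
      then obtain i where i: "i \<in> B" "x = ?f i" by blast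
      then have "n \<le> i" using x by (auto split: if_splits)
      then show "x \<in> (\<lambda>i. int m - 1 - int i) ` {i. i < m \<and> i + n \<in> B}"
        using i sub by (intro image_eqI[of _ _ "i - n"]) auto
    next
      fix x assume "x \<in> (\<lambda>i. int m - 1 - int i) ` {i. i < m \<and> i + n \<in> B}"
      then obtain i where "i < m" "i + n \<in> B" "x = int m - 1 - int i" by blast
      then show "x \<in> ?f ` B \<inter> {0..}" by (auto intro!: image_eqI[of _ _ "i + n"])
    qed
    ultimately show ?thesis
      by (simp add: block_weight_def lr_cumulant_faces card_image inj_on_def)
  qed
  have "\<phi> (a ^ n * b ^ m) = (\<Sum>\<pi>\<in>BNC ?\<chi>. \<Prod>B\<in>\<pi>. lr_cumulant \<phi> (nths ?\<chi> B) (nths ?as B))"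
    using lr_moment_cumulant[of ?\<chi> ?as \<phi>] False by (auto simp: prod_list_replicate)
  also have "\<dots> = (\<Sum>\<pi> | partition_on {..<n + m} \<pi> \<and> noncrossing (face_less ?\<chi>) \<pi>.
      \<Prod>B\<in>\<pi>. block_weight \<phi> a b (?f ` B))"
    using weight by (intro sum.cong prod.cong) (auto simp: BNC_def)
  also have "\<dots> = nc_sum (block_weight \<phi> a b) (?f ` {..<n + m})"
    by (rule nc_sum_reindex[OF inj order])
  finally show ?thesis unfolding img by simp
qed (use assms in simp)


section \<open>Functional equations for moments and cumulants\<close>

definition full_moment_series :: "('a::ring_1 \<Rightarrow> complex) \<Rightarrow> 'a \<Rightarrow> complex fps" where
  "full_moment_series \<phi> a = Abs_fps (\<lambda>n. \<phi> (a ^ n))"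

lemma full_moment_series_eq:
  "\<phi> 1 = 1 \<Longrightarrow> full_moment_series \<phi> a = 1 + moment_series \<phi> a"
  by (simp add: full_moment_series_def moment_series_def fps_eq_iff)

text \<open>Split off the block of the least position: it contributes one factor \<open>X\<close>, and
  \<open>open_sum_interval\<close> evaluates the rest, so that \<open>M = 1 + X M f(X M)\<close> with \<open>f(x) = c(x) / x\<close>,
  which is \<open>M = 1 + c(X M)\<close>.\<close>

lemma cumulant_series_compose:
  assumes "\<phi> 1 = 1"
  shows "cumulant_series \<phi> a oo (fps_X * full_moment_series \<phi> a) = moment_series \<phi> a"
proof -
  let ?w = "\<lambda>B :: int set. free_cumulant \<phi> a (card B)"
  let ?M = "full_moment_series \<phi> a" and ?c = "cumulant_series \<phi> a"
  let ?Q = "fps_shift 1 ?c oo (fps_X * ?M)"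
  have "?M $ Suc n = (?M * ?Q) $ n" for n
  proof -
    have "?M $ Suc n = nc_sum ?w {- int (Suc n)..<- int (Suc n) + int (Suc n)}"
      by (subst nc_sum_free_cumulant[of \<phi>, OF assms]) (simp add: full_moment_series_def)
    also have "{- int (Suc n)..<- int (Suc n) + int (Suc n)}
        = insert (- int (Suc n)) {- int n..<- int n + int n}" by auto
    also have "nc_sum ?w \<dots> = open_sum ?w (\<lambda>V. ?w (insert (- int (Suc n)) V)) {- int n..<- int n + int n}"
      by (rule nc_sum_insert_least) auto
    also have "\<dots> = (?M * ?Q) $ n"
    proof (rule open_sum_interval[where lo = "- int n"])
      fix V assume "V \<subseteq> {- int n..<- int n + int n}"
      then have "finite V" "- int (Suc n) \<notin> V" by (auto intro: finite_subset)
      then show "?w (insert (- int (Suc n)) V) = fps_shift 1 ?c $ card V"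
        by (simp add: cumulant_series_def)
    qed (simp_all add: nc_sum_free_cumulant[of \<phi>, OF assms] full_moment_series_def)
    finally show ?thesis .
  qed
  then have "fps_shift 1 ?M = ?M * ?Q" by (simp add: fps_eq_iff)
  then have "?M = 1 + fps_X * (?M * ?Q)"
    using fps_split[of ?M] assms by (simp add: full_moment_series_def)
  moreover have "?c oo (fps_X * ?M) = fps_X * ?M * ?Q"
    by (subst fps_compose_split) (simp_all add: cumulant_series_def)
  ultimately show ?thesis
    using full_moment_series_eq[of \<phi> a] assms by (simp add: mult.assoc)
qed

text \<open>Let \<open>\<kappa>(z, w)\<close> be the sum of \<open>c\<^sub>a(z)\<close> and \<open>K(z, w)\<close>; it collects the cumulants of all blocks
  with at least one left position.  Splitting off the block of the leftmost position gives
  \<open>H = M\<^sub>b + z H F\<close>, where \<open>F\<close> is the value of \<open>\<kappa>(z, w) / z\<close> at \<open>(z M\<^sub>a, w M\<^sub>b)\<close>.  Multiplied by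
  \<open>M\<^sub>a\<close> this reads \<open>M\<^sub>a H = M\<^sub>a M\<^sub>b + H (c\<^sub>a(z M\<^sub>a) + K(z M\<^sub>a, w M\<^sub>b))\<close>, and \<open>c\<^sub>a(z M\<^sub>a) = M\<^sub>a - 1\<close>
  makes \<open>M\<^sub>a H\<close> cancel.\<close>

lemma pair_moment_series_relation:
  fixes a b :: "'a::ring_1"
  assumes "\<phi> 1 = 1"
  defines "Ma \<equiv> full_moment_series \<phi> a" and "Mb \<equiv> full_moment_series \<phi> b"
  shows "pair_moment_series \<phi> a b *
      (1 - fps2_subst (pair_cumulant_series \<phi> a b) (fps_X * Ma) (fps_X * Mb))
    = in_z Ma * in_w Mb"
proof -
  let ?w = "block_weight \<phi> a b"
  let ?H = "pair_moment_series \<phi> a b" and ?K = "pair_cumulant_series \<phi> a b"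
  \<comment> \<open>The series \<open>(c\<^sub>a(z) + K(z, w)) / z\<close>.\<close>
  define F where "F = Abs_fps (\<lambda>r. Abs_fps (\<lambda>l. face_cumulant \<phi> a b (Suc l) r))"
  let ?sub = "\<lambda>G. fps2_subst G (fps_X * Ma) (fps_X * Mb)"
  have "?H $ m $ Suc n = (?H * ?sub F) $ m $ n" for m n
  proof -
    have "?H $ m $ Suc n = nc_sum ?w {- int (Suc n)..<int m}"
      by (subst nc_sum_two_faced[of \<phi>, OF assms(1)]) (simp add: pair_moment_series_def fps2_def)
    also have "{- int (Suc n)..<int m} = insert (- int (Suc n)) {- int n..<int m}" by auto
    also have "nc_sum ?w \<dots> = open_sum ?w (\<lambda>V. ?w (insert (- int (Suc n)) V)) {- int n..<int m}"
      by (rule nc_sum_insert_least) auto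
    also have "\<dots> = (?H * ?sub F) $ m $ n"
    proof (rule open_sum_two_faced)
      fix V assume V: "V \<subseteq> {- int n..<int m}"
      let ?x = "- int (Suc n)"
      have "insert ?x V \<inter> {0..} = V \<inter> {0..}" "insert ?x V \<inter> {..<0} = insert ?x (V \<inter> {..<0})" by auto
      moreover have "finite V" "?x \<notin> V" using V by (auto intro: finite_subset)
      ultimately show "?w (insert ?x V) = F $ card (V \<inter> {0..}) $ card (V \<inter> {..<0})"
        by (simp add: block_weight_def F_def)
    qed (simp_all add: nc_sum_left nc_sum_right nc_sum_two_faced assms(1) Ma_def Mb_def
        full_moment_series_def pair_moment_series_def fps2_def)
    finally show ?thesis .
  qed
  moreover have "?H $ m $ 0 = Mb $ m" for m
    by (simp add: Mb_def full_moment_series_def pair_moment_series_def fps2_def)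
  ultimately have "?H $ m $ n = (in_w Mb + in_z fps_X * (?H * ?sub F)) $ m $ n" for m n
    by (cases n) simp_all
  then have H: "?H = in_w Mb + in_z fps_X * (?H * ?sub F)"
    by (simp add: fps_eq_iff)
  have "in_z fps_X * F = in_z (cumulant_series \<phi> a) + ?K"
  proof (intro fps_ext)
    fix r l
    show "(in_z fps_X * F) $ r $ l = (in_z (cumulant_series \<phi> a) + ?K) $ r $ l"
      by (cases l) (simp_all add: F_def cumulant_series_def pair_cumulant_series_def fps2_def
          face_cumulant_def)
  qed
  then have "?sub (in_z fps_X * F) = in_z (cumulant_series \<phi> a oo (fps_X * Ma)) + ?sub ?K"
    by (simp only: fps2_subst_add fps2_subst_in_z)
  moreover have "?sub (in_z fps_X * F) = in_z (fps_X * Ma) * ?sub F"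
    by (simp add: fps2_subst_mult fps2_subst_in_z)
  ultimately have "in_z (fps_X * Ma) * ?sub F
      = in_z (cumulant_series \<phi> a oo (fps_X * Ma)) + ?sub ?K" by simp
  also have "cumulant_series \<phi> a oo (fps_X * Ma) = Ma - 1"
    using cumulant_series_compose[of \<phi>, OF assms(1)] full_moment_series_eq[of \<phi>, OF assms(1)]
    unfolding Ma_def by simp
  finally have F: "in_z (fps_X * Ma) * ?sub F = in_z Ma - 1 + ?sub ?K" by simp
  have "in_z Ma * ?H = in_z Ma * in_w Mb + ?H * (in_z (fps_X * Ma) * ?sub F)"
    by (subst H) (simp add: algebra_simps)
  then show ?thesis unfolding F by (simp add: algebra_simps)
qed


section \<open>The S-transform\<close>

lemma fps2_to_fls2_conv: "fps2_to_fls2 F = fps_to_fls (fps_map fps_to_fls F)"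
  by (simp add: fps2_to_fls2_def fps_map_def)

interpretation to_fls2_hom: coeff_hom fps2_to_fls2
  by unfold_locales
    (simp_all add: fps2_to_fls2_conv to_fls_hom.map_add to_fls_hom.map_mult to_fls_hom.map_one
      fls_times_fps_to_fls)

lemma fps2_to_fls2_var_z: "fps2_to_fls2 (in_z fps_X) = var_z"
  by (simp add: fps2_to_fls2_conv var_z_def to_fls_hom.map_const)

lemma fps2_to_fls2_var_w: "fps2_to_fls2 (in_w fps_X) = var_w"
  by (simp add: fps2_to_fls2_conv var_w_def to_fls_hom.map_X const_hom.map_X)

lemma fps2_to_fls2_eq_0_iff: "fps2_to_fls2 F = 0 \<longleftrightarrow> F = 0"
  by (simp add: fps2_to_fls2_def fps_eq_iff[of _ 0])

lemma fps_inv_nth_0: "fps_inv f $ 0 = 0"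
  by (simp add: fps_inv_def)

lemma fps_inv_unique_right:
  fixes f g :: "complex fps"
  assumes "f $ 0 = 0" "f $ 1 \<noteq> 0" "g $ 0 = 0" "f oo g = fps_X"
  shows "g = fps_inv f"
proof -
  have "g = (fps_inv f oo f) oo g"
    unfolding fps_inv[OF assms(1,2)] using assms(3) by simp
  also have "\<dots> = fps_inv f oo (f oo g)" using assms by (intro fps_compose_assoc[symmetric])
  also have "\<dots> = fps_inv f" unfolding assms(4) by simp
  finally show ?thesis .
qed

lemma free_cumulant_1: "free_cumulant \<phi> a 1 = \<phi> a"
proof -
  have "\<pi> = {{..<1}}" if p: "partition_on {..<1::nat} \<pi>" for \<pi>
  proof (rule ccontr)
    assume "\<pi> \<noteq> {{..<1}}"
    moreover obtain B where B: "B \<in> \<pi>" "0 \<in> B"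
      using partition_onD1[OF p] by blast
    moreover have "B \<subseteq> {..<1}" using p B(1) by (auto simp: partition_on_def)
    ultimately have "card B < 1" using proper_block_card[OF p] by blast
    then show False using B(2) finite_subset[OF \<open>B \<subseteq> {..<1}\<close>] by auto
  qed
  then have none: "NC 1 - {{{..<1}}} = {}" unfolding NC_def by blast
  show ?thesis unfolding free_cumulant.simps[of \<phi> a 1] none by simp
qed

text \<open>The equation \<open>c(X M) = \<psi>\<close>, evaluated at the inverse of \<open>\<psi>\<close>, exhibits \<open>X M\<close> at that inverse as
  the inverse of \<open>c\<close>.\<close>

lemma cumulant_series_inverse:
  assumes "\<phi> 1 = 1" "\<phi> a \<noteq> 0"
  shows "(fps_X * full_moment_series \<phi> a) oo fps_inv (moment_series \<phi> a)
    = fps_inv (cumulant_series \<phi> a)"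
    and "full_moment_series \<phi> a oo fps_inv (moment_series \<phi> a) = 1 + fps_X"
proof -
  let ?M = "full_moment_series \<phi> a" and ?\<psi> = "moment_series \<phi> a" and ?c = "cumulant_series \<phi> a"
  have \<psi>: "?\<psi> $ 0 = 0" "?\<psi> $ 1 \<noteq> 0" using assms by (simp_all add: moment_series_def)
  then have inv: "?\<psi> oo fps_inv ?\<psi> = fps_X" by (rule fps_inv_right)
  have inv0: "fps_inv ?\<psi> $ 0 = 0" by (rule fps_inv_nth_0)
  show "?M oo fps_inv ?\<psi> = 1 + fps_X"
    by (simp add: full_moment_series_eq[of \<phi>, OF assms(1)] fps_compose_add_distrib inv)
  show "(fps_X * ?M) oo fps_inv ?\<psi> = fps_inv ?c"
  proof (rule fps_inv_unique_right)
    show "?c $ 0 = 0" "?c $ 1 \<noteq> 0"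
      using assms free_cumulant_1[of \<phi> a] by (simp_all add: cumulant_series_def)
    show "(fps_X * ?M oo fps_inv ?\<psi>) $ 0 = 0" by simp
    have "?c oo (fps_X * ?M oo fps_inv ?\<psi>) = (?c oo fps_X * ?M) oo fps_inv ?\<psi>"
      using inv0 by (subst fps_compose_assoc) simp_all
    then show "?c oo (fps_X * ?M oo fps_inv ?\<psi>) = fps_X"
      using cumulant_series_compose[of \<phi>, OF assms(1)] inv by simp
  qed
qed

lemma pair_moment_cumulant_at_inverses:
  assumes "\<phi> 1 = 1" "\<phi> a \<noteq> 0" "\<phi> b \<noteq> 0"
  shows "fps2_subst (pair_moment_series \<phi> a b)
        (fps_inv (moment_series \<phi> a)) (fps_inv (moment_series \<phi> b)) *
      (1 - fps2_subst (pair_cumulant_series \<phi> a b)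
        (fps_inv (cumulant_series \<phi> a)) (fps_inv (cumulant_series \<phi> b)))
    = (1 + in_z fps_X) * (1 + in_w fps_X)"
proof -
  let ?H = "pair_moment_series \<phi> a b" and ?K = "pair_cumulant_series \<phi> a b"
  let ?Ma = "full_moment_series \<phi> a" and ?Mb = "full_moment_series \<phi> b"
  let ?f = "fps_inv (moment_series \<phi> a)" and ?g = "fps_inv (moment_series \<phi> b)"
  let ?sub = "\<lambda>F. fps2_subst F ?f ?g"
  have zero: "?f $ 0 = 0" "?g $ 0 = 0" by (simp_all add: fps_inv_nth_0)
  note diff = coeff_hom.hom_diff[OF fps2_subst_hom[OF zero], of 1, unfolded fps2_subst_1]
  have "?sub ?H * (1 - ?sub (fps2_subst ?K (fps_X * ?Ma) (fps_X * ?Mb)))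
      = ?sub (in_z ?Ma * in_w ?Mb)"
    using pair_moment_series_relation[of \<phi>, OF assms(1), of a b]
    by (simp flip: diff fps2_subst_mult[OF zero])
  also have "?sub (fps2_subst ?K (fps_X * ?Ma) (fps_X * ?Mb))
      = fps2_subst ?K (fps_inv (cumulant_series \<phi> a)) (fps_inv (cumulant_series \<phi> b))"
    using zero assms by (simp add: fps2_subst_subst cumulant_series_inverse(1))
  also have "?sub (in_z ?Ma * in_w ?Mb) = in_z (1 + fps_X) * in_w (1 + fps_X)"
    using zero assms by (simp add: fps2_subst_mult fps2_subst_in_z fps2_subst_in_w
        cumulant_series_inverse(2))
  also have "in_z (1 + fps_X) = 1 + in_z fps_X" by (simp flip: fps_const_add)
  also have "in_w (1 + fps_X) = 1 + in_w fps_X" by (simp add: const_hom.map_add const_hom.map_one)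
  finally show ?thesis .
qed

text \<open>This makes the right-hand side of the theorem a power series: the denominator \<open>z w\<close> cancels,
  since \<open>K\<close> is divisible by \<open>z w\<close> and the substituted series have no constant term.\<close>

lemma fps2_subst_multiple_of_zw:
  assumes "f $ 0 = 0" "g $ 0 = 0"
    and "F = in_z fps_X * in_w fps_X * G"
  shows "\<exists>P. fps2_subst F f g = in_z fps_X * in_w fps_X * P"
proof -
  have "f = fps_X * fps_shift 1 f" "g = fps_X * fps_shift 1 g"
    using fps_split[of f] fps_split[of g] assms by simp_all
  then have "in_z f = in_z fps_X * in_z (fps_shift 1 f)" "in_w g = in_w fps_X * in_w (fps_shift 1 g)"
    by (metis fps_const_mult, metis const_hom.map_mult)
  moreover have "fps2_subst F f g = in_z f * in_w g * fps2_subst G f g"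
    using assms by (simp add: fps2_subst_mult fps2_subst_in_z fps2_subst_in_w)
  ultimately have "fps2_subst F f g
      = in_z fps_X * in_w fps_X * (in_z (fps_shift 1 f) * in_w (fps_shift 1 g) * fps2_subst G f g)"
    by (simp add: mult_ac)
  then show ?thesis by blast
qed

lemma pair_cumulant_series_multiple_of_zw:
  "pair_cumulant_series \<phi> a b
    = in_z fps_X * in_w fps_X * fps2 (\<lambda>n m. pair_cumulant \<phi> a b (Suc n) (Suc m))"
proof (intro fps_ext)
  fix m n
  show "pair_cumulant_series \<phi> a b $ m $ n
      = (in_z fps_X * in_w fps_X * fps2 (\<lambda>n m. pair_cumulant \<phi> a b (Suc n) (Suc m))) $ m $ n"
    by (cases n; cases m)
      (simp_all add: pair_cumulant_series_def fps2_def const_hom.map_X mult.assoc)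
qed

theorem proposition4p2:
  fixes scale :: "complex \<Rightarrow> 'a::ring_1 \<Rightarrow> 'a"
    and \<phi> :: "'a \<Rightarrow> complex"
    and a b :: 'a
  assumes "nc_probability_space scale \<phi>"
    and "\<phi> a = 1" and "\<phi> b = 1"
  shows "S_transform \<phi> a b \<in> range fps2_to_fls2 \<and>
    S_transform \<phi> a b =
      1 + (1 + var_z + var_w) / (var_z * var_w) *
        fps2_to_fls2 (fps2_subst (pair_cumulant_series \<phi> a b)
          (fps_inv (cumulant_series \<phi> a)) (fps_inv (cumulant_series \<phi> b)))"
proof -
  have one: "\<phi> 1 = 1" using assms(1) by (rule nc_probability_space.unital)
  let ?H = "fps2_subst (pair_moment_series \<phi> a b)
    (fps_inv (moment_series \<phi> a)) (fps_inv (moment_series \<phi> b))"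
  let ?K = "fps2_subst (pair_cumulant_series \<phi> a b)
    (fps_inv (cumulant_series \<phi> a)) (fps_inv (cumulant_series \<phi> b))"
  define h where "h = fps2_to_fls2 ?H"
  define k where "k = fps2_to_fls2 ?K"
  note hom = to_fls2_hom.hom_add to_fls2_hom.hom_mult to_fls2_hom.hom_one fps2_to_fls2_var_z
    fps2_to_fls2_var_w
  have rel: "?H * (1 - ?K) = (1 + in_z fps_X) * (1 + in_w fps_X)"
    using assms one by (intro pair_moment_cumulant_at_inverses) simp_all
  have hk: "h * (1 - k) = (1 + var_z) * (1 + var_w)"
    using arg_cong[OF rel, of fps2_to_fls2] by (simp add: hom h_def k_def to_fls2_hom.hom_diff)
  \<comment> \<open>The moment series is a divisor of a series with constant term \<open>1\<close>, so division by it is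
    genuine.\<close>
  have "((1 + in_z fps_X) * (1 + in_w fps_X)) $ 0 $ 0 = (1 :: complex)"
    by (simp add: const_hom.map_X)
  then have "(1 + in_z fps_X) * (1 + in_w fps_X) \<noteq> 0" by force
  then have "?H \<noteq> 0" using rel by force
  then have h: "h \<noteq> 0" by (simp add: h_def fps2_to_fls2_eq_0_iff)
  have zw: "var_z \<noteq> 0" "var_w \<noteq> 0"
    by (simp_all add: var_z_def var_w_def)
  have S: "S_transform \<phi> a b = 1 + (1 + var_z + var_w) / (var_z * var_w) * k"
  proof -
    have k: "k = 1 - (1 + var_z) * (1 + var_w) / h" using hk h by (simp add: field_simps)
    show ?thesis
      unfolding S_transform_def h_def[symmetric] k using h zw by (simp add: field_simps)
  qed
  obtain P where P: "?K = in_z fps_X * in_w fps_X * P"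
    by (rule exE[OF fps2_subst_multiple_of_zw[OF fps_inv_nth_0 fps_inv_nth_0
            pair_cumulant_series_multiple_of_zw]])
  have k: "k = var_z * var_w * fps2_to_fls2 P" by (simp only: k_def P hom)
  have "S_transform \<phi> a b = 1 + (1 + var_z + var_w) * fps2_to_fls2 P"
    unfolding S k using zw by simp
  also have "\<dots> = fps2_to_fls2 (1 + (1 + in_z fps_X + in_w fps_X) * P)"
    by (simp only: hom)
  finally have "S_transform \<phi> a b \<in> range fps2_to_fls2" by blast
  with S show ?thesis unfolding k_def by blast
qed

end
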